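(* Let $\Omega\subset\mathbb{R}^3$ (or $\mathbb{R}^2$) be a polyhedral (polygonal) domain with a consistent triangulation $\mathcal{T}$ satisfying the minimal angle condition $\inf_{K\in\mathcal{T}}\rho(K)/r(K)=:\alpha_0>0$, where $\rho(K)$ and $r(K)$ are the diameters of the inscribed and circumscribed spheres (circles) of the element $K$. Let $X$ be the finite element space of continuous (vector-valued) functions which are polynomials of degree $p\ge 1$ on every element $K\in\mathcal{T}$. Let $\delta$ be a filtering radius function with $\max_{x\in K}|\delta(x)|\le C_\delta\, r(K)$ for all $K\in\mathcal{T}$, with $C_\delta$ independent of $K$, and let $a(u)$ be an indicator function with $0\le a(u)\le 1$. Let $G=I-F$ with $F=F(u)$ the nonlinear differential filter on $X$ defined below. Then for every $w\in X$, $$\widetilde c\,(\delta^2 a(u)\nabla w,\nabla w)\le (G\,w,w)\le (\delta^2 a(u)\nabla w,\nabla w),$$ where the constant $\widetilde c>0$ is independent of $w$, of the indicator $a(\cdot)$ and of the filtering radius $\delta$; it may depend only on $p$, $C_\delta$ and $\alpha_0$.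
   Context: $(\cdot,\cdot)$ and $\|\cdot\|$ denote the $L^2(\Omega)$ inner product and norm. Nonlinear differential filter: given a sufficiently smooth vector field $u$, an indicator function $a(u)$ (a function of $x$, depending on $u$ and $\nabla u$) with values in $[0,1]$, a filtering radius $\delta=\delta(x)$, and a space $X$, for $w\in L^2(\Omega)^3$ the filtered field $F(u)w\in X$ is the solution of $(\delta^2 a(u)\nabla(F(u)w),\nabla v)+(F(u)w,v)=(w,v)$ for all $v\in X$ (in the finite-dimensional setting this problem is well posed; alternatively assume $a(u)\ge\varepsilon>0$). The operator $G:=I-F(u)$, i.e. $w_g=Gw$ solves $(\delta^2 a(u)\nabla w_g,\nabla v)+(w_g,v)=(\delta^2 a(u)\nabla w,\nabla v)$ for all $v\in X$. *)

theory Defs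
  imports "HOL-Analysis.Analysis"
begin

definition triangulation :: "(real^'n) set set \<Rightarrow> bool" where
  "triangulation T \<longleftrightarrow> finite T \<and> T \<noteq> {} \<and>
     (\<forall>K\<in>T. (int CARD('n)) simplex K) \<and>
     (\<forall>K\<in>T. \<forall>L\<in>T. (K \<inter> L) face_of K \<and> (K \<inter> L) face_of L)"

definition insc_diam :: "(real^'n) set \<Rightarrow> real" where
  "insc_diam K = 2 * Sup {e. \<exists>x. ball x e \<subseteq> K}"

definition circ_diam :: "(real^'n) set \<Rightarrow> real" where
  "circ_diam K = 2 * (THE R. \<exists>c. \<forall>v. v extreme_point_of K \<longrightarrow> dist c v = R)"

definition poly_le :: "nat \<Rightarrow> (real^'n \<Rightarrow> real) \<Rightarrow> bool" where
  "poly_le p g \<longleftrightarrow> (\<exists>c :: ('n \<Rightarrow> nat) \<Rightarrow> real.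
     g = (\<lambda>x. \<Sum>\<alpha>\<in>{\<alpha>::'n \<Rightarrow> nat. sum \<alpha> UNIV \<le> p}. c \<alpha> * (\<Prod>i\<in>UNIV. (x $ i) ^ (\<alpha> i))))"

definition FE_space :: "nat \<Rightarrow> (real^'n) set set \<Rightarrow> (real^'n \<Rightarrow> real^'n) set" where
  "FE_space p T = {w. continuous_on (\<Union>T) w \<and> (\<forall>x. x \<notin> \<Union>T \<longrightarrow> w x = 0) \<and>
     (\<forall>K\<in>T. \<forall>i. \<exists>g. poly_le p g \<and> (\<forall>x\<in>K. w x $ i = g x))}"

definition L2ip :: "(real^'n) set \<Rightarrow> (real^'n \<Rightarrow> real^'n) \<Rightarrow> (real^'n \<Rightarrow> real^'n) \<Rightarrow> real" where
  "L2ip \<Omega> f g = integral \<Omega> (\<lambda>x. f x \<bullet> g x)"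

definition grad_dot :: "(real^'n \<Rightarrow> real^'n) \<Rightarrow> (real^'n \<Rightarrow> real^'n) \<Rightarrow> real^'n \<Rightarrow> real" where
  "grad_dot f g x = (\<Sum>j\<in>UNIV. frechet_derivative f (at x) (axis j 1) \<bullet> frechet_derivative g (at x) (axis j 1))"

definition wgrad_ip :: "(real^'n) set \<Rightarrow> (real^'n \<Rightarrow> real) \<Rightarrow> (real^'n \<Rightarrow> real) \<Rightarrow>
    (real^'n \<Rightarrow> real^'n) \<Rightarrow> (real^'n \<Rightarrow> real^'n) \<Rightarrow> real" where
  "wgrad_ip \<Omega> \<delta> a f g = integral \<Omega> (\<lambda>x. (\<delta> x)\<^sup>2 * a x * grad_dot f g x)"

text \<open>F(u) w in X: (delta^2 a nabla (F w), nabla v) + (F w, v) = (w, v) for all v in X.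
  Here a stands for the indicator function a(u) (a function of x).\<close>
definition nl_filter :: "(real^'n \<Rightarrow> real^'n) set \<Rightarrow> (real^'n) set \<Rightarrow> (real^'n \<Rightarrow> real) \<Rightarrow>
    (real^'n \<Rightarrow> real) \<Rightarrow> (real^'n \<Rightarrow> real^'n) \<Rightarrow> (real^'n \<Rightarrow> real^'n)" where
  "nl_filter X \<Omega> \<delta> a w = (THE z. z \<in> X \<and>
     (\<forall>v\<in>X. wgrad_ip \<Omega> \<delta> a z v + L2ip \<Omega> z v = L2ip \<Omega> w v))"

definition G_op :: "(real^'n \<Rightarrow> real^'n) set \<Rightarrow> (real^'n) set \<Rightarrow> (real^'n \<Rightarrow> real) \<Rightarrow>
    (real^'n \<Rightarrow> real) \<Rightarrow> (real^'n \<Rightarrow> real^'n) \<Rightarrow> (real^'n \<Rightarrow> real^'n)" where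
  "G_op X \<Omega> \<delta> a w = (\<lambda>x. w x - nl_filter X \<Omega> \<delta> a w x)"

end

theory Submission
  imports Defs "HOL-Library.Function_Algebras"
begin

text \<open>
  Write \<open>A(f, g)\<close> for the weighted gradient form, \<open>z = F w\<close> and \<open>g = G w = w - z\<close>. Testing the equation
  \<open>A(z, v) = (g, v)\<close> with \<open>v = w\<close> and \<open>v = g\<close> gives \<open>(g, w) = A(z, z) + (g, g)\<close> and
  \<open>A(w, w) = A(z, z) + 2 (g, g) + A(g, g)\<close>. The upper bound is immediate, and the lower bound follows
  with constant \<open>1 / (2 + C)\<close> from the inverse inequality \<open>A(g, g) \<le> C (g, g)\<close>.
  On a single simplex the inverse inequality needs no affine reference element: by shape regularity the
  simplex lies between two concentric cubes of size comparable to its circumradius, and after translation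
  and scaling both cubes are fixed, so that the claim is the comparison of two quadratic forms on the
  finite-dimensional space of polynomials of degree at most \<open>p\<close>. Finite dimension is expressed throughout by a
  finite separating family of linear functionals (point evaluations), which avoids choosing bases.
\<close>

text \<open>Mesh independence is a cancellation on each element: an inverse inequality costs a
  factor of order 1 / \<open>circ_diam K\<close>^2, and the bound on \<delta> pays for it with
  \<open>circ_diam K\<close>^2. Nothing bounds the weight from below. It may vanish on whole
  elements, so the gradient form is only semidefinite, and the L2 term alone makes the filter
  equation uniquely solvable. A second obstacle shapes the abstract part. Derivatives of finite
  element functions are under control only inside the elements, and the integral is additive only on
  integrable functions, so the forms can be shown to be bilinear on the finite element space but not
  on all functions. Linearity and positivity are therefore stated relative to a subspace, and
  functions are made a real vector space so that \<open>subspace\<close> applies to polynomials and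
  finite element functions alike.\<close>

instantiation "fun" :: (type, real_vector) real_vector
begin

definition scaleR_fun :: "real \<Rightarrow> ('a \<Rightarrow> 'b) \<Rightarrow> 'a \<Rightarrow> 'b"
  where "scaleR_fun c f = (\<lambda>x. c *\<^sub>R f x)"

instance
  by standard (simp_all add: scaleR_fun_def fun_eq_iff scaleR_add_right scaleR_add_left)

end

lemma scaleR_fun_apply [simp]: "(c *\<^sub>R f) x = c *\<^sub>R f x"
  by (simp add: scaleR_fun_def)

subsection \<open>Semidefinite forms on finite-dimensional spaces\<close>

definition linear_form_on :: "'v::real_vector set \<Rightarrow> ('v \<Rightarrow> real) \<Rightarrow> bool" where
  "linear_form_on V L \<longleftrightarrow> (\<forall>u\<in>V. \<forall>v\<in>V. \<forall>c. L (u + c *\<^sub>R v) = L u + c * L v)"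

text \<open>Linearity is required in the second argument only; symmetry transfers it to the first.
  Definiteness is left out because the weight of the gradient form may vanish.\<close>

definition psd_form_on :: "'v::real_vector set \<Rightarrow> ('v \<Rightarrow> 'v \<Rightarrow> real) \<Rightarrow> bool" where
  "psd_form_on V B \<longleftrightarrow> (\<forall>u\<in>V. \<forall>v\<in>V. B u v = B v u) \<and> (\<forall>u\<in>V. linear_form_on V (B u)) \<and> (\<forall>v\<in>V. 0 \<le> B v v)"

definition separates :: "('v::real_vector \<Rightarrow> real) set \<Rightarrow> 'v set \<Rightarrow> bool" where
  "separates \<Phi> V \<longleftrightarrow> (\<forall>\<phi>\<in>\<Phi>. linear_form_on V \<phi>) \<and> (\<forall>v\<in>V. (\<forall>\<phi>\<in>\<Phi>. \<phi> v = 0) \<longrightarrow> v = 0)"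

lemma linear_form_onD:
  "linear_form_on V L \<Longrightarrow> u \<in> V \<Longrightarrow> v \<in> V \<Longrightarrow> L (u + c *\<^sub>R v) = L u + c * L v"
  by (simp add: linear_form_on_def)

lemma linear_form_on_0: "linear_form_on V L \<Longrightarrow> subspace V \<Longrightarrow> L 0 = 0"
  using linear_form_onD[of V L 0 0 1] by (simp add: subspace_0)

lemma linear_form_on_subset: "linear_form_on V L \<Longrightarrow> W \<subseteq> V \<Longrightarrow> linear_form_on W L"
  unfolding linear_form_on_def by blast

lemma psd_form_on_subset: "psd_form_on V B \<Longrightarrow> W \<subseteq> V \<Longrightarrow> psd_form_on W B"
  unfolding psd_form_on_def by (meson linear_form_on_subset subsetD)

lemma psd_form_on_add_right:
  "psd_form_on V B \<Longrightarrow> u \<in> V \<Longrightarrow> v \<in> V \<Longrightarrow> w \<in> V \<Longrightarrow> B w (u + c *\<^sub>R v) = B w u + c * B w v"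
  by (simp add: psd_form_on_def linear_form_on_def)

lemma psd_form_on_commute: "psd_form_on V B \<Longrightarrow> u \<in> V \<Longrightarrow> v \<in> V \<Longrightarrow> B u v = B v u"
  unfolding psd_form_on_def by blast

lemma psd_form_on_nonneg: "psd_form_on V B \<Longrightarrow> v \<in> V \<Longrightarrow> 0 \<le> B v v"
  unfolding psd_form_on_def by blast

lemma psd_form_on_linear: "psd_form_on V B \<Longrightarrow> v \<in> V \<Longrightarrow> linear_form_on V (B v)"
  unfolding psd_form_on_def by blast

lemma subspace_add_scaleR: "subspace V \<Longrightarrow> u \<in> V \<Longrightarrow> v \<in> V \<Longrightarrow> u + c *\<^sub>R v \<in> V"
  by (simp add: subspace_add subspace_scale)

lemma psd_form_on_add_scaleR:
  assumes "psd_form_on V B" "subspace V" "u \<in> V" "v \<in> V"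
  shows "B (u + c *\<^sub>R v) (u + c *\<^sub>R v) = B u u + 2 * c * B u v + c\<^sup>2 * B v v"
proof -
  have m: "u + c *\<^sub>R v \<in> V" using assms by (simp add: subspace_add_scaleR)
  have "B (u + c *\<^sub>R v) (u + c *\<^sub>R v) = B (u + c *\<^sub>R v) u + c * B (u + c *\<^sub>R v) v"
    using assms m by (simp add: psd_form_on_add_right)
  also have "\<dots> = B u (u + c *\<^sub>R v) + c * B v (u + c *\<^sub>R v)"
    using assms m by (simp add: psd_form_on_commute[OF assms(1)])
  also have "\<dots> = B u u + 2 * c * B u v + c\<^sup>2 * B v v"
    using assms by (simp add: psd_form_on_add_right psd_form_on_commute[OF assms(1), of v u]
        power2_eq_square algebra_simps)
  finally show ?thesis .
qed

text \<open>The degenerate case of Cauchy-Schwarz: along \<open>u + c *\<^sub>R v\<close> the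
  quadratic form is affine in c, and a nonzero slope would make it negative somewhere.\<close>

lemma psd_form_on_null:
  assumes B: "psd_form_on V B" and V: "subspace V" "u \<in> V" "v \<in> V" and 0: "B v v = 0"
  shows "B u v = 0"
proof (rule ccontr)
  assume nz: "B u v \<noteq> 0"
  \<comment> \<open>Chosen so that the affine function takes the value -1.\<close>
  define c where "c = - (B u u + 1) / (2 * B u v)"
  have "0 \<le> B (u + c *\<^sub>R v) (u + c *\<^sub>R v)"
    using B V by (simp add: psd_form_on_nonneg subspace_add_scaleR)
  also have "\<dots> = B u u + 2 * c * B u v" using psd_form_on_add_scaleR[OF B V] 0 by simp
  also have "\<dots> = - 1" using nz by (simp add: c_def field_simps)
  finally show False by simp
qed

lemma linear_form_on_kernel:
  assumes "linear_form_on V \<phi>" "subspace V"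
  shows "subspace {v \<in> V. \<phi> v = 0}"
proof -
  have "\<phi> (x + y) = 0" if "x \<in> V" "y \<in> V" "\<phi> x = 0" "\<phi> y = 0" for x y
    using linear_form_onD[OF assms(1) that(1,2), of 1] that by simp
  moreover have "\<phi> (c *\<^sub>R x) = 0" if "x \<in> V" "\<phi> x = 0" for x c
    using linear_form_onD[OF assms(1) subspace_0[OF assms(2)] that(1), of c] that
      linear_form_on_0[OF assms] by simp
  ultimately show ?thesis
    using assms linear_form_on_0[OF assms] by (auto simp: subspace_def)
qed

text \<open>One Gram-Schmidt step for a possibly degenerate form. The assumption
  \<open>riesz\<close> is representability on the kernel of \<phi>; it yields a projection q of e
  onto that kernel, and d is e - q scaled to \<open>\<phi> d = 1\<close>. Both inductions over
  separating families below rely on this splitting.\<close>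

lemma orthogonal_complement_of_kernel:
  assumes V: "subspace V" and B: "psd_form_on V B" and \<phi>: "linear_form_on V \<phi>" "e \<in> V" "\<phi> e \<noteq> 0"
    and riesz: "\<And>L. linear_form_on {v\<in>V. \<phi> v = 0} L \<Longrightarrow> (\<And>v. v\<in>V \<Longrightarrow> \<phi> v = 0 \<Longrightarrow> B v v = 0 \<Longrightarrow> L v = 0)
             \<Longrightarrow> \<exists>z\<in>{v\<in>V. \<phi> v = 0}. \<forall>v\<in>{v\<in>V. \<phi> v = 0}. B z v = L v"
  obtains d where "d \<in> V" "\<And>v. v \<in> V \<Longrightarrow> \<phi> v = 0 \<Longrightarrow> B v d = 0"
    "\<And>v. v \<in> V \<Longrightarrow> \<exists>u\<in>V. \<phi> u = 0 \<and> v = u + \<phi> v *\<^sub>R d"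
proof -
  obtain q where q: "q \<in> V" "\<phi> q = 0" "\<And>v. v \<in> V \<Longrightarrow> \<phi> v = 0 \<Longrightarrow> B q v = B e v"
  proof -
    have "linear_form_on {v\<in>V. \<phi> v = 0} (B e)"
      by (rule linear_form_on_subset[OF psd_form_on_linear[OF B \<open>e \<in> V\<close>]]) auto
    from riesz[OF this psd_form_on_null[OF B V \<open>e \<in> V\<close>]] that show ?thesis by auto
  qed
  define d where "d = (1 / \<phi> e) *\<^sub>R (e + (-1) *\<^sub>R q)"
  have d: "d \<in> V" using q \<phi> V by (auto simp: d_def intro!: subspace_scale subspace_add_scaleR subspace_diff)
  \<comment> \<open>The leading 0 brings d into the shape u + c v to which the linearity rules
    apply.\<close>
  have d': "d = 0 + (1 / \<phi> e) *\<^sub>R (e + (-1) *\<^sub>R q)" by (simp add: d_def)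
  have eq: "e + (-1) *\<^sub>R q \<in> V" using q \<phi> V by (simp only: subspace_add_scaleR)
  have \<phi>d: "\<phi> d = 1"
    unfolding d' linear_form_onD[OF \<phi>(1) subspace_0[OF V] eq] linear_form_onD[OF \<phi>(1,2) q(1)]
    using linear_form_on_0[OF \<phi>(1) V] q \<phi> by simp
  have orth: "B v d = 0" if "v \<in> V" "\<phi> v = 0" for v
  proof -
    have "B v d = B v 0 + (1 / \<phi> e) * (B v e + (-1) * B v q)"
      unfolding d' psd_form_on_add_right[OF B subspace_0[OF V] eq that(1)]
        psd_form_on_add_right[OF B \<phi>(2) q(1) that(1)] ..
    then show ?thesis
      using q(3)[OF that] linear_form_on_0[OF psd_form_on_linear[OF B that(1)] V]
        psd_form_on_commute[OF B that(1) \<phi>(2)] psd_form_on_commute[OF B that(1) q(1)] by simp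
  qed
  have "\<exists>u\<in>V. \<phi> u = 0 \<and> v = u + \<phi> v *\<^sub>R d" if "v \<in> V" for v
  proof (rule bexI[of _ "v + (- \<phi> v) *\<^sub>R d"])
    show "v + (- \<phi> v) *\<^sub>R d \<in> V" using that d V by (simp only: subspace_add_scaleR)
    show "\<phi> (v + (- \<phi> v) *\<^sub>R d) = 0 \<and> v = (v + (- \<phi> v) *\<^sub>R d) + \<phi> v *\<^sub>R d"
      using linear_form_onD[OF \<phi>(1) that d, of "- \<phi> v"] \<phi>d by simp
  qed
  with d orth show ?thesis using that by blast
qed

text \<open>For a semidefinite form the equation B z = L is solvable only if L vanishes on the null
  vectors of B; this condition also suffices. Removing \<phi> from the family leaves one that still
  separates the kernel of \<phi>. A solution on that kernel is corrected along the orthogonal vector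
  d, which does not disturb the equations already satisfied.\<close>

lemma riesz_representation_separated:
  assumes "finite \<Phi>" "subspace V" "separates \<Phi> V" "psd_form_on V B" "linear_form_on V L"
    "\<And>v. v \<in> V \<Longrightarrow> B v v = 0 \<Longrightarrow> L v = 0"
  shows "\<exists>z\<in>V. \<forall>v\<in>V. B z v = L v"
  using assms
proof (induction \<Phi> arbitrary: V L rule: finite_induct)
  case empty
  then have "V = {0}" using subspace_0 by (auto simp: separates_def)
  then show ?case
    using linear_form_on_0[OF empty.prems(4,1)]
      linear_form_on_0[OF psd_form_on_linear[OF empty.prems(3)] empty.prems(1)] by auto
next
  case (insert \<phi> \<Phi>)
  let ?W = "{v \<in> V. \<phi> v = 0}"
  have \<phi>: "linear_form_on V \<phi>" using insert.prems by (simp add: separates_def)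
  have W: "subspace ?W" using linear_form_on_kernel[OF \<phi> insert.prems(1)] .
  have sepW: "separates \<Phi> ?W"
    using insert.prems(2) by (auto simp: separates_def intro: linear_form_on_subset)
  have BW: "psd_form_on ?W B" by (rule psd_form_on_subset[OF insert.prems(3)]) auto
  have riesz: "\<exists>z\<in>?W. \<forall>v\<in>?W. B z v = M v"
    if "linear_form_on ?W M" "\<And>v. v \<in> V \<Longrightarrow> \<phi> v = 0 \<Longrightarrow> B v v = 0 \<Longrightarrow> M v = 0" for M
    by (rule insert.IH[OF W sepW BW that(1)]) (use that(2) in simp)
  have LW: "linear_form_on ?W L" by (rule linear_form_on_subset[OF insert.prems(4)]) auto
  obtain z where z: "z \<in> V" "\<phi> z = 0" "\<And>v. v \<in> V \<Longrightarrow> \<phi> v = 0 \<Longrightarrow> B z v = L v"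
    using riesz[OF LW insert.prems(5)] by auto
  show ?case
  proof (cases "\<forall>v\<in>V. \<phi> v = 0")
    case True
    then show ?thesis using z by blast
  next
    case False
    then obtain e where e: "e \<in> V" "\<phi> e \<noteq> 0" by blast
    obtain d where d: "d \<in> V" "\<And>v. v \<in> V \<Longrightarrow> \<phi> v = 0 \<Longrightarrow> B v d = 0"
      "\<And>v. v \<in> V \<Longrightarrow> \<exists>u\<in>V. \<phi> u = 0 \<and> v = u + \<phi> v *\<^sub>R d"
      by (rule orthogonal_complement_of_kernel[OF insert.prems(1,3) \<phi> e], rule riesz, assumption, assumption, rule that, assumption+)
    \<comment> \<open>If \<open>B d d = 0\<close>, then also \<open>L d = 0\<close> and the quotient
      is 0, so \<open>t * B d d = L d\<close> holds in every case.\<close>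
    define t where "t = L d / B d d"
    have t: "t * B d d = L d" using insert.prems(5)[OF d(1)] by (auto simp: t_def)
    have zt: "z + t *\<^sub>R d \<in> V" using z d insert.prems(1) by (simp add: subspace_add_scaleR)
    have "B (z + t *\<^sub>R d) v = L v" if v: "v \<in> V" for v
    proof -
      obtain u where u: "u \<in> V" "\<phi> u = 0" "v = u + \<phi> v *\<^sub>R d" using d(3)[OF v] by blast
      have *: "B (z + t *\<^sub>R d) x = B x z + t * B x d" if "x \<in> V" for x
        using psd_form_on_add_right[OF insert.prems(3) z(1) d(1) that]
          psd_form_on_commute[OF insert.prems(3) zt that] by simp
      have "B (z + t *\<^sub>R d) v = B (z + t *\<^sub>R d) u + \<phi> v * B (z + t *\<^sub>R d) d"
        by (subst u(3), rule psd_form_on_add_right[OF insert.prems(3) u(1) d(1) zt])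
      also have "\<dots> = L u + \<phi> v * L d"
        using *[OF u(1)] *[OF d(1)] z(3)[OF u(1,2)] d(2)[OF u(1,2)] d(2)[OF z(1,2)] t
          psd_form_on_commute[OF insert.prems(3) u(1) z(1)] psd_form_on_commute[OF insert.prems(3) d(1) z(1)] by simp
      also have "\<dots> = L v" by (subst (2) u(3), rule linear_form_onD[OF insert.prems(4) u(1) d(1), symmetric])
      finally show ?thesis .
    qed
    then show ?thesis using zt by blast
  qed
qed

text \<open>Takes the place of the compactness argument for comparing seminorms in finite dimension.
  In the splitting v = u + c d the form B has no cross term, while the cross term of N is absorbed
  at the price of a factor 2.\<close>

lemma psd_form_dominated_separated:
  assumes "finite \<Phi>" "subspace V" "separates \<Phi> V" "psd_form_on V B" "psd_form_on V N"
    "\<And>v. v \<in> V \<Longrightarrow> B v v = 0 \<Longrightarrow> N v v = 0"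
  shows "\<exists>C\<ge>0. \<forall>v\<in>V. N v v \<le> C * B v v"
  using assms
proof (induction \<Phi> arbitrary: V rule: finite_induct)
  case empty
  then have "V = {0}" using subspace_0 by (auto simp: separates_def)
  then show ?case
    using linear_form_on_0[OF psd_form_on_linear[OF empty.prems(4)] empty.prems(1)]
      linear_form_on_0[OF psd_form_on_linear[OF empty.prems(3)] empty.prems(1)] by auto
next
  case (insert \<phi> \<Phi>)
  note B = insert.prems(3) and N = insert.prems(4) and V = insert.prems(1)
  let ?W = "{v \<in> V. \<phi> v = 0}"
  have \<phi>: "linear_form_on V \<phi>" using insert.prems by (simp add: separates_def)
  have W: "subspace ?W" using linear_form_on_kernel[OF \<phi> insert.prems(1)] .
  have sepW: "separates \<Phi> ?W"
    using insert.prems(2) by (auto simp: separates_def intro: linear_form_on_subset)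
  have BW: "psd_form_on ?W B" "psd_form_on ?W N"
    by (rule psd_form_on_subset[OF B] psd_form_on_subset[OF N], auto)+
  have riesz: "\<exists>z\<in>?W. \<forall>v\<in>?W. B z v = M v"
    if "linear_form_on ?W M" "\<And>v. v \<in> V \<Longrightarrow> \<phi> v = 0 \<Longrightarrow> B v v = 0 \<Longrightarrow> M v = 0" for M
    by (rule riesz_representation_separated[OF insert.hyps(1) W sepW BW(1) that(1)]) (use that(2) in simp)
  obtain C where C: "C \<ge> 0" "\<And>v. v \<in> V \<Longrightarrow> \<phi> v = 0 \<Longrightarrow> N v v \<le> C * B v v"
  proof -
    have "\<exists>C\<ge>0. \<forall>v\<in>?W. N v v \<le> C * B v v"
      by (rule insert.IH[OF W sepW BW]) (use insert.prems(5) in simp)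
    with that show ?thesis by auto
  qed
  show ?case
  proof (cases "\<forall>v\<in>V. \<phi> v = 0")
    case True
    then show ?thesis using C by blast
  next
    case False
    then obtain e where e: "e \<in> V" "\<phi> e \<noteq> 0" by blast
    obtain d where d: "d \<in> V" "\<And>v. v \<in> V \<Longrightarrow> \<phi> v = 0 \<Longrightarrow> B v d = 0"
      "\<And>v. v \<in> V \<Longrightarrow> \<exists>u\<in>V. \<phi> u = 0 \<and> v = u + \<phi> v *\<^sub>R d"
      by (rule orthogonal_complement_of_kernel[OF V B \<phi> e], rule riesz, assumption, assumption, rule that, assumption+)
    define D where "D = N d d / B d d"
    have D: "N d d = D * B d d" "D \<ge> 0"
      using insert.prems(5)[OF d(1)] psd_form_on_nonneg[OF B d(1)] psd_form_on_nonneg[OF N d(1)] by (auto simp: D_def)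
    have "N v v \<le> (2 * C + 2 * D) * B v v" if v: "v \<in> V" for v
    proof -
      obtain u where u: "u \<in> V" "\<phi> u = 0" "v = u + \<phi> v *\<^sub>R d" using d(3)[OF v] by blast
      define c where "c = \<phi> v"
      have uv: "v = u + c *\<^sub>R d" using u(3) by (simp add: c_def)
      \<comment> \<open>Positivity at the reflected vector bounds the cross term of N at v
        itself.\<close>
      have "0 \<le> N (u + (-c) *\<^sub>R d) (u + (-c) *\<^sub>R d)"
        by (intro psd_form_on_nonneg[OF N] subspace_add_scaleR V u d)
      then have "2 * c * N u d \<le> N u u + c\<^sup>2 * N d d"
        using psd_form_on_add_scaleR[OF N V u(1) d(1), of "-c"] by simp
      then have "N v v \<le> 2 * N u u + 2 * (c\<^sup>2 * N d d)"
        unfolding uv psd_form_on_add_scaleR[OF N V u(1) d(1)] by linarith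
      also have "\<dots> \<le> 2 * (C * B u u) + 2 * (c\<^sup>2 * (D * B d d))"
        using C(2)[OF u(1,2)] D by simp
      also have "\<dots> \<le> (2 * C + 2 * D) * (B u u + c\<^sup>2 * B d d)"
        using C(1) D(2) psd_form_on_nonneg[OF B u(1)] psd_form_on_nonneg[OF B d(1)] by (simp add: algebra_simps)
      also have "B u u + c\<^sup>2 * B d d = B v v"
        unfolding uv psd_form_on_add_scaleR[OF B V u(1) d(1)] using d(2)[OF u(1,2)] by simp
      finally show ?thesis .
    qed
    then show ?thesis using C D by (intro exI[of _ "2 * C + 2 * D"]) auto
  qed
qed

section \<open>The two-sided filter estimate for abstract forms\<close>

lemma filter_bounds:
  assumes V: "subspace V" and A: "psd_form_on V A" and B: "psd_form_on V B"
    and z: "z \<in> V" and w: "w \<in> V" and eq: "\<And>v. v \<in> V \<Longrightarrow> A z v + B z v = B w v"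
    and inv: "A (w - z) (w - z) \<le> C * B (w - z) (w - z)" and C: "C \<ge> 0"
  shows "1 / (2 + C) * A w w \<le> B (w - z) w" "B (w - z) w \<le> A w w"
proof -
  define g where "g = w - z"
  have g: "g \<in> V" using V w z by (simp add: g_def subspace_diff)
  have wz: "w = z + 1 *\<^sub>R g" by (simp add: g_def)
  have Bw: "B w v = B z v + B g v" if "v \<in> V" for v
    using psd_form_on_add_right[OF B z g that, of 1] wz
      psd_form_on_commute[OF B w that] psd_form_on_commute[OF B z that] psd_form_on_commute[OF B g that] by simp
  have Azv: "A z v = B g v" if "v \<in> V" for v using eq[OF that] Bw[OF that] by simp
  have Bgw: "B g w = A z z + B g g"
    using Azv[OF w] psd_form_on_add_right[OF A z g z, of 1] wz Azv[OF g] by simp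
  have Aw: "A w w = A z z + 2 * B g g + A g g"
    using psd_form_on_add_scaleR[OF A V z g, of 1] wz Azv[OF g] by simp
  have nn: "0 \<le> A z z" "0 \<le> B g g" "0 \<le> A g g"
    using psd_form_on_nonneg[OF A] psd_form_on_nonneg[OF B] z g by auto
  show "B (w - z) w \<le> A w w" using Bgw Aw nn by (simp flip: g_def)
  \<comment> \<open>The coefficient of \<open>A z z\<close> is enlarged from 1 to 2 + C, which makes
    the right-hand side a multiple of \<open>B g w\<close>.\<close>
  have "A w w \<le> (2 + C) * A z z + (2 + C) * B g g"
    using Aw inv nn C mult_nonneg_nonneg[OF C nn(1)] unfolding g_def[symmetric] distrib_right by linarith
  then have "A w w \<le> (2 + C) * B g w" by (simp add: Bgw algebra_simps)
  then show "1 / (2 + C) * A w w \<le> B (w - z) w"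
    using C by (simp flip: g_def add: field_simps)
qed

text \<open>Gaussian elimination on functions, by induction on their number. The family may be
  linearly dependent: the conclusion concerns the values of the combination on S, not its
  coefficients.\<close>

lemma finite_determining_set:
  fixes b :: "'i \<Rightarrow> 'a \<Rightarrow> real"
  assumes "finite I"
  shows "\<exists>P\<subseteq>S. finite P \<and>
    (\<forall>c. (\<forall>x\<in>P. (\<Sum>i\<in>I. c i * b i x) = 0) \<longrightarrow> (\<forall>x\<in>S. (\<Sum>i\<in>I. c i * b i x) = 0))"
  using assms
proof (induction "card I" arbitrary: I b)
  case 0
  then show ?case by auto
next
  case (Suc n)
  show ?case
  proof (cases "\<exists>k\<in>I. \<exists>x\<in>S. b k x \<noteq> 0")
    case False
    then show ?thesis by (intro exI[of _ "{}"]) simp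
  next
    case True
    then obtain k y where k: "k \<in> I" "y \<in> S" "b k y \<noteq> 0" by blast
    \<comment> \<open>Every \<open>b' i\<close> vanishes at y. A combination of the
      \<open>b i\<close> that is zero at y has \<open>c k\<close> fixed by the other coefficients
      and is then the same combination of the \<open>b' i\<close>.\<close>
    define b' where "b' i x = b i x - b i y / b k y * b k x" for i x
    obtain P where P: "P \<subseteq> S" "finite P"
      "\<And>c. (\<forall>x\<in>P. (\<Sum>i\<in>I-{k}. c i * b' i x) = 0) \<Longrightarrow> (\<forall>x\<in>S. (\<Sum>i\<in>I-{k}. c i * b' i x) = 0)"
      using Suc.hyps(1)[of "I - {k}" b'] Suc.hyps(2) Suc.prems k(1) by force
    have "\<forall>x\<in>S. (\<Sum>i\<in>I. c i * b i x) = 0" if c: "\<forall>x\<in>insert y P. (\<Sum>i\<in>I. c i * b i x) = 0" for c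
    proof -
      have "c k * b k y = - (\<Sum>i\<in>I-{k}. c i * b i y)"
        using c sum.remove[OF Suc.prems k(1), of "\<lambda>i. c i * b i y"] by simp
      then have ck: "c k = - (\<Sum>i\<in>I-{k}. c i * b i y / b k y)"
        using k(3) by (simp add: field_simps flip: sum_divide_distrib)
      have "(\<Sum>i\<in>I. c i * b i x) = (\<Sum>i\<in>I-{k}. c i * b' i x)" for x
      proof -
        have "(\<Sum>i\<in>I-{k}. c i * b' i x) = (\<Sum>i\<in>I-{k}. c i * b i x) - (\<Sum>i\<in>I-{k}. c i * b i y / b k y) * b k x"
          by (simp add: b'_def algebra_simps sum_subtractf sum_distrib_left)
        also have "\<dots> = (\<Sum>i\<in>I-{k}. c i * b i x) + c k * b k x" by (simp add: ck)
        also have "\<dots> = (\<Sum>i\<in>I. c i * b i x)"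
          using sum.remove[OF Suc.prems k(1), of "\<lambda>i. c i * b i x"] by simp
        finally show ?thesis by simp
      qed
      then show ?thesis using P(3)[of c] c by simp
    qed
    then show ?thesis using P(1,2) k(2) by (intro exI[of _ "insert y P"] conjI allI impI) (blast, simp, assumption)
  qed
qed

subsection \<open>Polynomials in several variables\<close>

abbreviation multi_monomial :: "('n::finite \<Rightarrow> nat) \<Rightarrow> real^'n \<Rightarrow> real" where
  "multi_monomial \<alpha> x \<equiv> (\<Prod>i\<in>UNIV. (x $ i) ^ \<alpha> i)"

lemma finite_multi_indices: "finite {\<alpha>::'n::finite \<Rightarrow> nat. sum \<alpha> UNIV \<le> p}"
proof (rule finite_subset)
  show "{\<alpha>::'n \<Rightarrow> nat. sum \<alpha> UNIV \<le> p} \<subseteq> PiE UNIV (\<lambda>_. {..p})"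
    by (force simp: PiE_def extensional_def intro: order.trans[OF member_le_sum])
qed (simp add: finite_PiE)

lemma poly_le_subspace: "subspace {g. poly_le p g}"
proof (rule subspaceI)
  show "0 \<in> {g. poly_le p g}"
    by (auto simp: poly_le_def fun_eq_iff intro!: exI[of _ "\<lambda>_. 0"])
next
  fix f g :: "real^'n \<Rightarrow> real"
  assume "f \<in> {g. poly_le p g}" "g \<in> {g. poly_le p g}"
  then obtain c d where
    "f = (\<lambda>x. \<Sum>\<alpha> | sum \<alpha> UNIV \<le> p. c \<alpha> * multi_monomial \<alpha> x)"
    "g = (\<lambda>x. \<Sum>\<alpha> | sum \<alpha> UNIV \<le> p. d \<alpha> * multi_monomial \<alpha> x)"
    by (auto simp: poly_le_def)
  then show "f + g \<in> {g. poly_le p g}"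
    by (auto simp: poly_le_def fun_eq_iff sum.distrib algebra_simps intro!: exI[of _ "\<lambda>\<alpha>. c \<alpha> + d \<alpha>"])
next
  fix f :: "real^'n \<Rightarrow> real" and r
  assume "f \<in> {g. poly_le p g}"
  then obtain c where
    "f = (\<lambda>x. \<Sum>\<alpha> | sum \<alpha> UNIV \<le> p. c \<alpha> * multi_monomial \<alpha> x)"
    by (auto simp: poly_le_def)
  then show "r *\<^sub>R f \<in> {g. poly_le p g}"
    by (auto simp: poly_le_def fun_eq_iff sum_distrib_left algebra_simps intro!: exI[of _ "\<lambda>\<alpha>. r * c \<alpha>"])
qed

lemma poly_le_axpy: "poly_le p f \<Longrightarrow> poly_le p g \<Longrightarrow> poly_le p (\<lambda>x. f x + c * g x)"
  using subspace_add_scaleR[OF poly_le_subspace, of f p g c] by (simp add: plus_fun_def scaleR_fun_def)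

lemma poly_le_cmult: "poly_le p f \<Longrightarrow> poly_le p (\<lambda>x. c * f x)"
  using subspace_scale[OF poly_le_subspace, of f p c] by (simp add: scaleR_fun_def)

lemma poly_le_sum: "(\<And>i. i \<in> I \<Longrightarrow> poly_le p (f i)) \<Longrightarrow> poly_le p (\<lambda>x. \<Sum>i\<in>I. f i x)"
proof (induction I rule: infinite_finite_induct)
  case (insert i I)
  then show ?case using poly_le_axpy[of p "f i" "\<lambda>x. \<Sum>i\<in>I. f i x" 1] by simp
qed (use subspace_0[OF poly_le_subspace] in \<open>simp_all add: zero_fun_def\<close>)

lemma poly_le_monomial: "sum \<alpha> UNIV \<le> p \<Longrightarrow> poly_le p (multi_monomial \<alpha>)"
  unfolding poly_le_def
  by (rule exI[of _ "\<lambda>\<beta>. if \<beta> = \<alpha> then 1 else 0"]) (simp add: finite_multi_indices if_distrib[of "\<lambda>x. x * _"] sum.delta cong: if_cong)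

lemma poly_le_mult:
  assumes "poly_le p f" "poly_le q g"
  shows "poly_le (p + q) (\<lambda>x. f x * g x)"
proof -
  obtain c d where
    f: "f = (\<lambda>x. \<Sum>\<alpha> | sum \<alpha> UNIV \<le> p. c \<alpha> * multi_monomial \<alpha> x)" and
    g: "g = (\<lambda>x. \<Sum>\<alpha> | sum \<alpha> UNIV \<le> q. d \<alpha> * multi_monomial \<alpha> x)"
    using assms by (auto simp: poly_le_def)
  have "(\<lambda>x. f x * g x) = (\<lambda>x. \<Sum>\<alpha> | sum \<alpha> UNIV \<le> p. \<Sum>\<beta> | sum \<beta> UNIV \<le> q.
      (c \<alpha> * d \<beta>) * multi_monomial (\<lambda>i. \<alpha> i + \<beta> i) x)"
    unfolding f g by (simp add: fun_eq_iff sum_product power_add prod.distrib algebra_simps)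
  then show ?thesis
    by (simp only:) (intro poly_le_sum poly_le_cmult poly_le_monomial, auto simp: sum.distrib intro: add_mono)
qed

lemma poly_le_const: "poly_le p (\<lambda>x. c)"
  using poly_le_cmult[OF poly_le_monomial[of "\<lambda>_. 0" p], of c] by simp

lemma poly_le_component: "poly_le 1 (\<lambda>x. x $ i)"
proof -
  have "(\<lambda>x. x $ i) = multi_monomial (\<lambda>j. if j = i then 1 else 0)"
    by (simp add: fun_eq_iff if_distrib[of "power _"] prod.delta cong: if_cong)
  then show ?thesis using poly_le_monomial[of "\<lambda>j. if j = i then 1 else 0" 1] by simp
qed

lemma poly_le_power: "poly_le p f \<Longrightarrow> poly_le (k * p) (\<lambda>x. f x ^ k)"
  by (induction k) (auto simp: poly_le_const dest: poly_le_mult)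

lemma poly_le_prod:
  "finite I \<Longrightarrow> (\<And>i. i \<in> I \<Longrightarrow> poly_le (p i) (f i)) \<Longrightarrow> poly_le (sum p I) (\<lambda>x. \<Prod>i\<in>I. f i x)"
  by (induction I rule: finite_induct) (auto simp: poly_le_const dest: poly_le_mult)

lemma poly_le_mono:
  assumes "poly_le p f" "p \<le> q" shows "poly_le q f"
proof -
  obtain c where f: "f = (\<lambda>x. \<Sum>\<alpha> | sum \<alpha> UNIV \<le> p. c \<alpha> * multi_monomial \<alpha> x)"
    using assms by (auto simp: poly_le_def)
  show ?thesis unfolding f using \<open>p \<le> q\<close>
    by (intro poly_le_sum poly_le_cmult poly_le_monomial) auto
qed

text \<open>Components of an affine argument have degree 1, so substitution keeps the total degree.
  This carries the polynomial space of an arbitrary cube to the reference cube.\<close>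

lemma poly_le_affinity:
  assumes "poly_le p g"
  shows "poly_le p (\<lambda>y. g (m *\<^sub>R y + a))"
proof -
  obtain c where g: "g = (\<lambda>x. \<Sum>\<alpha> | sum \<alpha> UNIV \<le> p. c \<alpha> * multi_monomial \<alpha> x)"
    using assms by (auto simp: poly_le_def)
  have 1: "poly_le 1 (\<lambda>y. (m *\<^sub>R y + a) $ i)" for i
    using poly_le_axpy[OF poly_le_const[of 1 "a $ i"] poly_le_component[of i], of m] by (simp add: add.commute)
  have "poly_le (\<Sum>i\<in>UNIV. \<alpha> i * 1) (\<lambda>y. multi_monomial \<alpha> (m *\<^sub>R y + a))" for \<alpha>
    by (intro poly_le_prod poly_le_power 1) simp
  then have "poly_le p (\<lambda>y. multi_monomial \<alpha> (m *\<^sub>R y + a))" if "sum \<alpha> UNIV \<le> p" for \<alpha>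
    using poly_le_mono that by fastforce
  then show ?thesis unfolding g by (intro poly_le_sum poly_le_cmult) auto
qed

lemma poly_le_real_polynomial_function: "poly_le p g \<Longrightarrow> real_polynomial_function g"
  unfolding poly_le_def
  by (auto simp: finite_multi_indices intro!: real_polynomial_function_sum real_polynomial_function.intros(2,4)
      real_polynomial_function_prod real_polynomial_function_power real_polynomial_function.intros(1)[OF bounded_linear_vec_nth])

section \<open>Derivatives of polynomials\<close>

lemma real_polynomial_function_C1:
  assumes "real_polynomial_function g"
  shows "\<exists>g'. (\<forall>x. (g has_derivative g' x) (at x)) \<and> (\<forall>v. continuous_on UNIV (\<lambda>x. g' x v))"
  using assms
proof induction
  case (linear f)
  then show ?case using bounded_linear_imp_has_derivative by (intro exI[of _ "\<lambda>_. f"]) auto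
next
  case (const c)
  then show ?case by (intro exI[of _ "\<lambda>_ _. 0"]) auto
next
  case (add f g)
  then obtain f' g' where "\<And>x. (f has_derivative f' x) (at x)" "\<And>x. (g has_derivative g' x) (at x)"
    "\<And>v. continuous_on UNIV (\<lambda>x. f' x v)" "\<And>v. continuous_on UNIV (\<lambda>x. g' x v)" by metis
  then show ?case
    by (intro exI[of _ "\<lambda>x v. f' x v + g' x v"]) (auto intro!: has_derivative_add continuous_on_add)
next
  case (mult f g)
  then obtain f' g' where *: "\<And>x. (f has_derivative f' x) (at x)" "\<And>x. (g has_derivative g' x) (at x)"
    "\<And>v. continuous_on UNIV (\<lambda>x. f' x v)" "\<And>v. continuous_on UNIV (\<lambda>x. g' x v)" by metis
  moreover have "continuous_on UNIV f" "continuous_on UNIV g"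
    using mult.hyps by (simp_all add: continuous_on_eq_continuous_at continuous_real_polymonial_function)
  ultimately show ?case
    by (intro exI[of _ "\<lambda>x v. f x * g' x v + f' x v * g x"])
       (auto intro!: has_derivative_mult continuous_intros)
qed

abbreviation pderiv_at :: "'n::finite \<Rightarrow> (real^'n \<Rightarrow> real) \<Rightarrow> real^'n \<Rightarrow> real" where
  "pderiv_at j g x \<equiv> frechet_derivative g (at x) (axis j 1)"

lemma poly_le_differentiable: "poly_le p g \<Longrightarrow> g differentiable (at x)"
  using real_polynomial_function_C1[OF poly_le_real_polynomial_function] by (blast intro: differentiableI)

lemma poly_le_continuous: "poly_le p g \<Longrightarrow> continuous_on S g"
  by (simp add: continuous_at_imp_continuous_on differentiable_imp_continuous_within poly_le_differentiable)

lemma poly_le_continuous_pderiv: "poly_le p g \<Longrightarrow> continuous_on S (pderiv_at j g)"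
proof -
  assume "poly_le p g"
  then obtain g' where g': "\<And>x. (g has_derivative g' x) (at x)" "continuous_on UNIV (\<lambda>x. g' x (axis j 1))"
    using real_polynomial_function_C1[OF poly_le_real_polynomial_function] by metis
  have "frechet_derivative g (at x) = g' x" for x
    using frechet_derivative_at[OF g'(1)] by simp
  then show ?thesis using continuous_on_subset[OF g'(2) subset_UNIV, of S] by simp
qed

lemma frechet_derivative_add_scaleR:
  fixes f g :: "'a::real_normed_vector \<Rightarrow> 'b::real_normed_vector"
  assumes "f differentiable (at x)" "g differentiable (at x)"
  shows "frechet_derivative (f + c *\<^sub>R g) (at x) v = frechet_derivative f (at x) v + c *\<^sub>R frechet_derivative g (at x) v"
proof -
  have "((f + c *\<^sub>R g) has_derivative (\<lambda>v. frechet_derivative f (at x) v + c *\<^sub>R frechet_derivative g (at x) v)) (at x)"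
    using assms unfolding plus_fun_def scaleR_fun_def frechet_derivative_works
    by (intro has_derivative_add has_derivative_scaleR_right)
  from frechet_derivative_at[OF this] show ?thesis by metis
qed

lemma poly_le_separated: "\<exists>\<Phi>. finite \<Phi> \<and> separates \<Phi> {g::real^'n \<Rightarrow> real. poly_le p g}"
proof -
  obtain P :: "(real^'n) set" where P: "finite P"
    "\<forall>c. (\<forall>x\<in>P. (\<Sum>\<alpha> | sum \<alpha> UNIV \<le> p. c \<alpha> * multi_monomial \<alpha> x) = 0) \<longrightarrow>
      (\<forall>x\<in>UNIV. (\<Sum>\<alpha> | sum \<alpha> UNIV \<le> p. c \<alpha> * multi_monomial \<alpha> x) = 0)"
    using finite_determining_set[OF finite_multi_indices[where 'n='n and p=p], where S=UNIV and b=multi_monomial] by (elim exE conjE) rule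
  have "g = 0" if "poly_le p g" "\<forall>x\<in>P. g x = 0" for g :: "real^'n \<Rightarrow> real"
  proof -
    obtain c where c: "g = (\<lambda>x. \<Sum>\<alpha> | sum \<alpha> UNIV \<le> p. c \<alpha> * multi_monomial \<alpha> x)"
      using \<open>poly_le p g\<close> by (auto simp: poly_le_def)
    show ?thesis using P(2)[rule_format, of c] that(2) by (auto simp: c fun_eq_iff)
  qed
  then have "\<forall>g. poly_le p g \<longrightarrow> (\<forall>x\<in>P. g x = 0) \<longrightarrow> g = 0" by blast
  then show ?thesis using P(1)
    by (intro exI[of _ "(\<lambda>x g. g x) ` P"] conjI) (simp, simp add: separates_def linear_form_on_def)
qed

text \<open>Along a ray through the origin a polynomial is a univariate polynomial, which vanishes identically
  if it vanishes near \<open>0\<close>.\<close>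

lemma poly_le_eq_0:
  assumes g: "poly_le p g" and e: "e > 0" "\<And>x. norm x < e \<Longrightarrow> g x = 0"
  shows "g = 0"
proof
  fix x
  obtain c where c: "g = (\<lambda>x. \<Sum>\<alpha> | sum \<alpha> UNIV \<le> p. c \<alpha> * multi_monomial \<alpha> x)"
    using assms by (auto simp: poly_le_def)
  define q :: "real poly" where "q = (\<Sum>\<alpha> | sum \<alpha> UNIV \<le> p. monom (c \<alpha> * multi_monomial \<alpha> x) (sum \<alpha> UNIV))"
  have q: "poly q t = g (t *\<^sub>R x)" for t
    by (simp add: q_def c poly_sum poly_monom power_mult_distrib prod.distrib power_sum algebra_simps)
  have "q = 0"
  proof (rule ccontr)
    assume "q \<noteq> 0"
    then have "finite {t. poly q t = 0}" by (rule poly_roots_finite)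
    \<comment> \<open>Adding 1 to the norm keeps the denominator positive when x = 0.\<close>
    moreover have "{0..<e / (norm x + 1)} \<subseteq> {t. poly q t = 0}"
    proof
      fix t assume t: "t \<in> {0..<e / (norm x + 1)}"
      then have "t * (norm x + 1) < e" using pos_less_divide_eq[of "norm x + 1" t e] by (simp add: add_nonneg_pos)
      moreover have "t * norm x \<le> t * (norm x + 1)" using t by (simp add: mult_left_mono)
      ultimately show "t \<in> {t. poly q t = 0}" using t e(2)[of "t *\<^sub>R x"] by (simp add: q)
    qed
    moreover have "infinite {0..<e / (norm x + 1)}" using e(1) by (simp add: infinite_Ico add_nonneg_pos)
    ultimately show False using finite_subset by blast
  qed
  then show "g x = 0 x" using q[of 1] by simp
qed

subsection \<open>The inverse inequality on cubes\<close>

text \<open>The algebraic laws are required only at points of S, so S can be the union of the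
  element interiors, where derivatives exist.\<close>

lemma psd_form_on_integral:
  fixes b :: "'v::real_vector \<Rightarrow> 'v \<Rightarrow> 'a::euclidean_space \<Rightarrow> real"
  assumes int: "\<And>f g. f \<in> V \<Longrightarrow> g \<in> V \<Longrightarrow> b f g integrable_on S"
    and comm: "\<And>f g x. f \<in> V \<Longrightarrow> g \<in> V \<Longrightarrow> x \<in> S \<Longrightarrow> b f g x = b g f x"
    and lin: "\<And>f g h c x. f \<in> V \<Longrightarrow> g \<in> V \<Longrightarrow> h \<in> V \<Longrightarrow> x \<in> S \<Longrightarrow> b f (g + c *\<^sub>R h) x = b f g x + c * b f h x"
    and nonneg: "\<And>f x. f \<in> V \<Longrightarrow> x \<in> S \<Longrightarrow> 0 \<le> b f f x"
  shows "psd_form_on V (\<lambda>f g. integral S (b f g))"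
  unfolding psd_form_on_def linear_form_on_def
proof (intro conjI ballI allI)
  fix f g assume fg: "f \<in> V" "g \<in> V"
  show "integral S (b f g) = integral S (b g f)"
    using comm[OF fg] by (intro integral_cong) auto
next
  fix f g h c assume V: "f \<in> V" "g \<in> V" "h \<in> V"
  have "integral S (b f (g + c *\<^sub>R h)) = integral S (\<lambda>x. b f g x + c * b f h x)"
    using lin[OF V] by (intro integral_cong) auto
  also have "\<dots> = integral S (b f g) + c * integral S (b f h)"
    using int V by (simp add: integral_add integrable_on_mult_right)
  finally show "integral S (b f (g + c *\<^sub>R h)) = integral S (b f g) + c * integral S (b f h)" .
next
  fix f assume "f \<in> V"
  then show "0 \<le> integral S (b f f)" using int nonneg by (intro integral_nonneg) auto
qed

lemma integral_eq_0_imp_eq_0_on_open: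
  fixes h :: "'a::euclidean_space \<Rightarrow> real"
  assumes "open U" "continuous_on U h" "h integrable_on U" "\<And>x. x \<in> U \<Longrightarrow> 0 \<le> h x"
    "integral U h = 0" "x \<in> U"
  shows "h x = 0"
proof -
  obtain a b where ab: "cbox a b \<subseteq> U" "x \<in> box a b"
    using open_contains_cbox[OF \<open>open U\<close> \<open>x \<in> U\<close>] by metis
  have cont: "continuous_on (cbox a b) h" using assms ab continuous_on_subset by blast
  have "0 \<le> integral (cbox a b) h"
    using ab assms(4) integrable_continuous[OF cont] by (intro integral_nonneg) auto
  moreover have "integral (cbox a b) h \<le> integral U h"
    using ab assms integrable_continuous[OF cont] by (intro integral_subset_le) auto
  ultimately have "(h has_integral 0) (cbox a b)"
    using integrable_integral[OF integrable_continuous[OF cont]] assms(5) by simp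
  moreover have "x \<in> cbox a b" using ab box_subset_cbox by blast
  ultimately show ?thesis
    using has_integral_0_cbox_imp_0[OF cont] ab assms(4) box_subset_cbox by blast
qed

text \<open>The closed ball of radius r in the maximum norm, so the side length is 2 r. Boxes go to
  boxes under translation and scaling, and continuous functions are integrable on them.\<close>

definition cube :: "real^'n \<Rightarrow> real \<Rightarrow> (real^'n) set" where
  "cube x r = cbox (x - vec r) (x + vec r)"

lemma mem_cube: "y \<in> cube x r \<longleftrightarrow> (\<forall>i. \<bar>y $ i - x $ i\<bar> \<le> r)"
  by (simp add: cube_def mem_box_cart abs_le_iff) (smt (verit))

lemma integral_cube_affinity:
  fixes f :: "real^'n \<Rightarrow> real"
  assumes "m > 0" "f integrable_on cube a (m * r)"
  shows "integral (cube 0 r) (\<lambda>y. f (m *\<^sub>R y + a)) = integral (cube a (m * r)) f / m ^ CARD('n)"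
proof -
  have *: "(a - vec (m * r) - a) /\<^sub>R m = - vec r" "(a + vec (m * r) - a) /\<^sub>R m = vec r"
    using assms(1) by (simp_all add: vec_eq_iff)
  have "(f has_integral integral (cube a (m * r)) f) (cbox (a - vec (m * r)) (a + vec (m * r)))"
    using assms(2) by (simp add: cube_def integrable_integral)
  from has_integral_affinity'[OF this assms(1), of a] show ?thesis
    unfolding * by (simp add: cube_def integral_unique divide_inverse)
qed

lemma pderiv_at_affinity:
  assumes "poly_le p g"
  shows "pderiv_at j (\<lambda>y. g (m *\<^sub>R y + a)) y = m * pderiv_at j g (m *\<^sub>R y + a)"
proof -
  let ?D = "frechet_derivative g (at (m *\<^sub>R y + a))"
  have D: "(g has_derivative ?D) (at (m *\<^sub>R y + a))"
    using poly_le_differentiable[OF assms] frechet_derivative_works by blast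
  have "((\<lambda>y. g (m *\<^sub>R y + a)) has_derivative (\<lambda>v. ?D (m *\<^sub>R v))) (at y)"
    by (rule has_derivative_compose[where f = "\<lambda>y. m *\<^sub>R y + a", OF _ D]) (auto intro!: derivative_eq_intros)
  from frechet_derivative_at[OF this] have "pderiv_at j (\<lambda>y. g (m *\<^sub>R y + a)) y = ?D (m *\<^sub>R axis j 1)" by metis
  then show ?thesis using linear_cmul[OF has_derivative_linear[OF D]] by simp
qed

text \<open>The L2 form of the small cube is definite on polynomials, since a polynomial that
  vanishes near 0 is zero. It therefore dominates every semidefinite form on that space, including
  the gradient form of the larger cube.\<close>

lemma inverse_inequality_reference_cube:
  assumes "\<beta> > 0"
  shows "\<exists>C\<ge>0. \<forall>g::real^'n \<Rightarrow> real. poly_le p g \<longrightarrow>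
    integral (cube 0 2) (\<lambda>x. \<Sum>j\<in>UNIV. (pderiv_at j g x)\<^sup>2) \<le> C * integral (cube 0 \<beta>) (\<lambda>x. (g x)\<^sup>2)"
proof -
  let ?V = "{g::real^'n \<Rightarrow> real. poly_le p g}"
  let ?N = "\<lambda>g h. integral (cube 0 2) (\<lambda>x. \<Sum>j\<in>UNIV. pderiv_at j g x * pderiv_at j h x)"
  let ?B = "\<lambda>g h. integral (cube 0 \<beta>) (\<lambda>x. g x * h x)"
  obtain \<Phi> where \<Phi>: "finite \<Phi>" "separates \<Phi> ?V" using poly_le_separated by blast
  have N: "psd_form_on ?V ?N"
  proof (rule psd_form_on_integral)
    fix f g assume "f \<in> ?V" "g \<in> ?V"
    then show "(\<lambda>x. \<Sum>j\<in>UNIV. pderiv_at j f x * pderiv_at j g x) integrable_on cube 0 2"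
      unfolding cube_def
      by (intro integrable_continuous continuous_intros poly_le_continuous_pderiv) auto
  next
    fix f g h :: "real^'n \<Rightarrow> real" and c x assume "f \<in> ?V" "g \<in> ?V" "h \<in> ?V"
    then have "pderiv_at j (g + c *\<^sub>R h) x = pderiv_at j g x + c * pderiv_at j h x" for j
      using frechet_derivative_add_scaleR[of g x h c] poly_le_differentiable[of p g x] poly_le_differentiable[of p h x] by simp
    then show "(\<Sum>j\<in>UNIV. pderiv_at j f x * pderiv_at j (g + c *\<^sub>R h) x) =
      (\<Sum>j\<in>UNIV. pderiv_at j f x * pderiv_at j g x) + c * (\<Sum>j\<in>UNIV. pderiv_at j f x * pderiv_at j h x)"
      by (simp add: algebra_simps sum.distrib sum_distrib_left)
  qed (auto simp: mult.commute sum_nonneg)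
  have intB: "(\<lambda>x. f x * g x) integrable_on cube 0 \<beta>" if "poly_le p f" "poly_le p g" for f g :: "real^'n \<Rightarrow> real"
    unfolding cube_def using that by (intro integrable_continuous continuous_intros poly_le_continuous)
  have B: "psd_form_on ?V ?B"
    by (rule psd_form_on_integral) (auto simp: algebra_simps intB)
  have "?N g g = 0" if g: "g \<in> ?V" "?B g g = 0" for g
  proof -
    have g': "poly_le p g" using g by simp
    have "g = 0"
    proof (rule poly_le_eq_0[OF g' assms])
      fix x :: "real^'n" assume "norm x < \<beta>"
      have "x \<in> cube 0 \<beta>"
        using \<open>norm x < \<beta>\<close> component_le_norm_cart[of x] by (auto simp: mem_cube intro: order.trans less_imp_le)
      have "((\<lambda>x. g x * g x) has_integral 0) (cube 0 \<beta>)"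
        using integrable_integral[OF intB[OF g' g']] g(2) by simp
      moreover have "(0::real^'n) \<in> box (- vec \<beta>) (vec \<beta>)" using assms by (simp add: mem_box_cart)
      ultimately have "g x * g x = 0"
        using has_integral_0_cbox_imp_0[of "- vec \<beta>" "vec \<beta>" "\<lambda>x. g x * g x" x] \<open>x \<in> cube 0 \<beta>\<close>
        by (force simp: cube_def intro!: continuous_intros poly_le_continuous[OF g'])
      then show "g x = 0" by simp
    qed
    then show ?thesis
      using linear_form_on_0[OF psd_form_on_linear[OF N g(1)] poly_le_subspace] by simp
  qed
  then show ?thesis
    using psd_form_dominated_separated[OF \<Phi>(1) poly_le_subspace \<Phi>(2) B N]
    by (simp add: power2_eq_square)
qed

text \<open>Scaling by R produces the factor R^2 from the squared gradient and the same Jacobian R^n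
  on both sides, which cancels. Hence C depends on neither R nor the centre.\<close>

lemma inverse_inequality_cube:
  fixes p :: nat
  assumes "\<beta> > 0"
  obtains C where "C \<ge> 0" "\<And>(g::real^'n \<Rightarrow> real) x R. poly_le p g \<Longrightarrow> R > 0 \<Longrightarrow>
    R\<^sup>2 * integral (cube x (2 * R)) (\<lambda>x. \<Sum>j\<in>UNIV. (pderiv_at j g x)\<^sup>2) \<le> C * integral (cube x (\<beta> * R)) (\<lambda>x. (g x)\<^sup>2)"
proof -
  obtain C where C: "C \<ge> 0" "\<And>g::real^'n \<Rightarrow> real. poly_le p g \<Longrightarrow>
    integral (cube 0 2) (\<lambda>x. \<Sum>j\<in>UNIV. (pderiv_at j g x)\<^sup>2) \<le> C * integral (cube 0 \<beta>) (\<lambda>x. (g x)\<^sup>2)"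
    using inverse_inequality_reference_cube[OF assms] by metis
  have "R\<^sup>2 * integral (cube x (2 * R)) (\<lambda>x. \<Sum>j\<in>UNIV. (pderiv_at j g x)\<^sup>2) \<le> C * integral (cube x (\<beta> * R)) (\<lambda>x. (g x)\<^sup>2)"
    if g: "poly_le p g" and R: "R > 0" for g :: "real^'n \<Rightarrow> real" and x R
  proof -
    let ?h = "\<lambda>y. g (R *\<^sub>R y + x)"
    have cont: "(\<lambda>x. \<Sum>j\<in>UNIV. (pderiv_at j g x)\<^sup>2) integrable_on cube x (R * 2)" "(\<lambda>x. (g x)\<^sup>2) integrable_on cube x (R * \<beta>)"
      unfolding cube_def
      by (intro integrable_continuous continuous_intros poly_le_continuous_pderiv[OF g] poly_le_continuous[OF g])+
    have "integral (cube 0 2) (\<lambda>x. \<Sum>j\<in>UNIV. (pderiv_at j ?h x)\<^sup>2) =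
        R\<^sup>2 * integral (cube 0 2) (\<lambda>y. \<Sum>j\<in>UNIV. (pderiv_at j g (R *\<^sub>R y + x))\<^sup>2)"
      by (simp add: pderiv_at_affinity[OF g] power_mult_distrib flip: sum_distrib_left)
    also have "\<dots> = R\<^sup>2 * integral (cube x (2 * R)) (\<lambda>x. \<Sum>j\<in>UNIV. (pderiv_at j g x)\<^sup>2) / R ^ CARD('n)"
      using integral_cube_affinity[OF R cont(1)] by (simp add: mult.commute)
    finally have "R\<^sup>2 * integral (cube x (2 * R)) (\<lambda>x. \<Sum>j\<in>UNIV. (pderiv_at j g x)\<^sup>2) / R ^ CARD('n)
       \<le> C * integral (cube x (\<beta> * R)) (\<lambda>x. (g x)\<^sup>2) / R ^ CARD('n)"
      using C(2)[OF poly_le_affinity[OF g, of R x]] integral_cube_affinity[OF R cont(2)] by (simp add: mult.commute)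
    then show ?thesis using R by (simp add: divide_le_cancel)
  qed
  with C(1) show ?thesis using that by blast
qed

subsection \<open>Simplices\<close>

lemma simplex_vertices:
  fixes K :: "(real^'n) set"
  assumes "(int CARD('n)) simplex K"
  obtains C where "\<not> affine_dependent C" "finite C" "card C = CARD('n) + 1" "K = convex hull C"
    "affine hull C = UNIV" "\<And>v. v extreme_point_of K \<longleftrightarrow> v \<in> C"
proof -
  obtain C where C: "\<not> affine_dependent C" "int (card C) = int CARD('n) + 1" "K = convex hull C"
    using assms by (auto simp: simplex_def)
  moreover have "finite C" using C(1) aff_independent_finite by blast
  moreover have "affine hull C = UNIV"
    using aff_dim_affine_independent[OF C(1)] C(2) by (simp flip: aff_dim_eq_full)
  moreover have "v extreme_point_of K \<longleftrightarrow> v \<in> C" for v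
    using C extreme_point_of_convex_hull_affine_independent by blast
  moreover have "card C = CARD('n) + 1" using C(2) by linarith
  ultimately show ?thesis using that[of C] by blast
qed

text \<open>Equidistance of \<open>z\<close> from \<open>v\<close> and \<open>v\<^sub>0\<close> prescribes the inner product of \<open>z\<close> with \<open>v - v\<^sub>0\<close>, and these
  differences form a basis.\<close>

lemma circumcentre_ex1:
  fixes C :: "'a::euclidean_space set"
  assumes indep: "\<not> affine_dependent C" and hull: "affine hull C = UNIV"
  shows "\<exists>!z. \<exists>R. \<forall>v\<in>C. dist z v = R"
proof -
  obtain v\<^sub>0 where v\<^sub>0: "v\<^sub>0 \<in> C" using hull by fastforce
  define D where "D = (\<lambda>v. v - v\<^sub>0) ` (C - {v\<^sub>0})"
  have D: "D = (\<lambda>x. - v\<^sub>0 + x) ` (C - {v\<^sub>0})" by (simp add: D_def)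
  have indD: "independent D"
    using affine_dependent_iff_dependent2[OF v\<^sub>0] indep D by simp
  have span: "span D = UNIV"
    using affine_hull_span2[OF v\<^sub>0] hull D by (metis surj_plus translation_galois)
  have equidist: "(\<exists>R. \<forall>v\<in>C. dist z v = R) \<longleftrightarrow> (\<forall>d\<in>D. z \<bullet> d = (d \<bullet> d) / 2 + v\<^sub>0 \<bullet> d)" for z
  proof -
    have "dist z v = dist z v\<^sub>0 \<longleftrightarrow> z \<bullet> (v - v\<^sub>0) = ((v - v\<^sub>0) \<bullet> (v - v\<^sub>0)) / 2 + v\<^sub>0 \<bullet> (v - v\<^sub>0)" for v
    proof -
      have "dist z v = dist z v\<^sub>0 \<longleftrightarrow> (z - v) \<bullet> (z - v) = (z - v\<^sub>0) \<bullet> (z - v\<^sub>0)"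
        by (simp add: dist_norm norm_eq)
      then show ?thesis by (auto simp: inner_diff inner_commute field_simps)
    qed
    moreover have "(\<exists>R. \<forall>v\<in>C. dist z v = R) \<longleftrightarrow> (\<forall>v\<in>C. dist z v = dist z v\<^sub>0)" using v\<^sub>0 by metis
    \<comment> \<open>The base vertex is missing from D, but its difference is 0, where the equation
      is trivial.\<close>
    moreover have "(\<forall>v\<in>C. P (v - v\<^sub>0)) \<longleftrightarrow> (\<forall>d\<in>D. P d)" if "P 0" for P
      using that v\<^sub>0 by (auto simp: D_def)
    from this[of "\<lambda>d. z \<bullet> d = (d \<bullet> d) / 2 + v\<^sub>0 \<bullet> d"]
    have "(\<forall>v\<in>C. z \<bullet> (v - v\<^sub>0) = ((v - v\<^sub>0) \<bullet> (v - v\<^sub>0)) / 2 + v\<^sub>0 \<bullet> (v - v\<^sub>0)) \<longleftrightarrow>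
      (\<forall>d\<in>D. z \<bullet> d = (d \<bullet> d) / 2 + v\<^sub>0 \<bullet> d)" by simp
    ultimately show ?thesis by simp
  qed
  obtain f :: "'a \<Rightarrow> real" where f: "linear f" "\<forall>d\<in>D. f d = (d \<bullet> d) / 2 + v\<^sub>0 \<bullet> d"
  proof -
    have "\<exists>f. linear f \<and> (\<forall>d\<in>D. f d = (d \<bullet> d) / 2 + v\<^sub>0 \<bullet> d)"
      by (rule linear_independent_extend[OF indD])
    with that show ?thesis by blast
  qed
  \<comment> \<open>\<open>adjoint f 1\<close> is the vector representing the functional f, hence
    the circumcentre.\<close>
  have "adjoint f 1 \<bullet> d = f d" for d
    using adjoint_works[OF f(1), of d 1] by (simp add: inner_commute)
  then have "\<forall>d\<in>D. adjoint f 1 \<bullet> d = (d \<bullet> d) / 2 + v\<^sub>0 \<bullet> d" using f(2) by simp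
  moreover have "z = w" if "\<forall>d\<in>D. z \<bullet> d = (d \<bullet> d) / 2 + v\<^sub>0 \<bullet> d" "\<forall>d\<in>D. w \<bullet> d = (d \<bullet> d) / 2 + v\<^sub>0 \<bullet> d" for z w
  proof -
    have "\<And>d. d \<in> D \<Longrightarrow> orthogonal (z - w) d" using that by (simp add: orthogonal_def inner_diff_left)
    then have "orthogonal (z - w) (z - w)" using orthogonal_to_span span by (metis UNIV_I)
    then show ?thesis by (simp add: orthogonal_self)
  qed
  ultimately show ?thesis unfolding equidist by blast
qed

text \<open>Uniqueness of the circumcentre makes the description operator in
  \<open>circ_diam\<close> meaningful. The ball contains K because it is convex and contains the
  vertices; a zero radius would force two distinct vertices to coincide.\<close>

lemma simplex_circumsphere:
  fixes K :: "(real^'n) set"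
  assumes K: "(int CARD('n)) simplex K"
  obtains c where "K \<subseteq> cball c (circ_diam K / 2)" "circ_diam K > 0"
proof -
  obtain C where C: "\<not> affine_dependent C" "finite C" "card C = CARD('n) + 1" "K = convex hull C"
    "affine hull C = UNIV" "\<And>v. v extreme_point_of K \<longleftrightarrow> v \<in> C"
    using simplex_vertices[OF K] by metis
  obtain c R where c: "\<forall>v\<in>C. dist c v = R" using circumcentre_ex1[OF C(1,5)] by blast
  have "(THE R. \<exists>c. \<forall>v. v extreme_point_of K \<longrightarrow> dist c v = R) = R"
  proof (rule the_equality)
    show "\<exists>c. \<forall>v. v extreme_point_of K \<longrightarrow> dist c v = R" using c C(6) by blast
  next
    fix R' assume "\<exists>c. \<forall>v. v extreme_point_of K \<longrightarrow> dist c v = R'"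
    then obtain c' where c': "\<forall>v\<in>C. dist c' v = R'" using C(6) by blast
    then have "c' = c" using c circumcentre_ex1[OF C(1,5)] by blast
    moreover have "C \<noteq> {}" using C(3) by auto
    ultimately show "R' = R" using c c' by fastforce
  qed
  then have R: "circ_diam K / 2 = R" by (simp add: circ_diam_def)
  obtain v w where vw: "v \<in> C" "w \<in> C" "v \<noteq> w"
  proof -
    have "card C \<ge> 2" using C(3) by simp
    then show ?thesis using that card_le_Suc0_iff_eq[OF C(2)] by fastforce
  qed
  have "R > 0"
  proof (rule ccontr)
    assume "\<not> R > 0"
    moreover have "dist c v \<ge> 0" "dist c w \<ge> 0" by simp_all
    moreover have "dist c v = R" "dist c w = R" using c vw(1,2) by auto
    ultimately have "dist c v = 0" "dist c w = 0" by linarith+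
    then show False using vw(3) by (metis dist_eq_0_iff)
  qed
  moreover have "K \<subseteq> cball c R"
    unfolding C(4) using c by (intro hull_minimal) auto
  ultimately show ?thesis using that R by simp
qed

lemma simplex_compact_convex_interior:
  fixes K :: "(real^'n) set"
  assumes "(int CARD('n)) simplex K"
  shows "compact K" "convex K" "interior K \<noteq> {}"
proof -
  obtain C where C: "\<not> affine_dependent C" "finite C" "K = convex hull C" "affine hull C = UNIV"
    using simplex_vertices[OF assms] by metis
  show "compact K" "convex K" using C finite_imp_compact_convex_hull by auto
  have "rel_interior K = interior K" using C by (simp add: rel_interior_interior affine_hull_convex_hull)
  moreover have "K \<noteq> {}" using C by auto
  ultimately show "interior K \<noteq> {}" using rel_interior_eq_empty \<open>convex K\<close> by metis
qed

text \<open>Both cubes are centred at the centre x of a nearly maximal inscribed ball. The supremum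
  in \<open>insc_diam\<close> need not be attained, so the ball is only taken larger than
  \<open>\<alpha> / 2 * R\<close>. The further factor \<open>1 / CARD('n)\<close> bounds the
  Euclidean norm by the sum of the components. On the outside, x lies in K, hence within 2 R of
  every point of K.\<close>

lemma simplex_between_cubes:
  fixes K :: "(real^'n) set"
  assumes K: "(int CARD('n)) simplex K" and \<alpha>: "\<alpha> > 0" "\<alpha> \<le> insc_diam K / circ_diam K"
  obtains x R where "circ_diam K = 2 * R" "R > 0" "K \<subseteq> cube x (2 * R)" "cube x (\<alpha> / (2 * CARD('n)) * R) \<subseteq> interior K"
proof -
  obtain c where c: "K \<subseteq> cball c (circ_diam K / 2)" "circ_diam K > 0" using simplex_circumsphere[OF K] .
  define R where "R = circ_diam K / 2"
  have R: "R > 0" "circ_diam K = 2 * R" using c by (auto simp: R_def)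
  let ?E = "{e. \<exists>x. ball x e \<subseteq> K}"
  have "\<alpha> * R \<le> Sup ?E" using \<alpha>(2) R by (simp add: insc_diam_def field_simps)
  moreover have \<alpha>R: "\<alpha> / 2 * R > 0" "\<alpha> / 2 * R < \<alpha> * R" using \<alpha>(1) R(1) by simp_all
  ultimately have "\<alpha> / 2 * R < Sup ?E" by linarith
  \<comment> \<open>The empty ball puts e = 0 into the set.\<close>
  moreover have "?E \<noteq> {}" using ball_empty[of 0] by blast
  ultimately obtain e where "e \<in> ?E" "\<alpha> / 2 * R < e" by (rule less_cSupE)
  then obtain x where ex: "ball x e \<subseteq> K" "\<alpha> / 2 * R < e" by blast
  have "e > 0" using ex(2) \<alpha>R by linarith
  then have "x \<in> K" using ex(1) by auto
  have "K \<subseteq> cube x (2 * R)"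
  proof
    fix y assume "y \<in> K"
    then have "dist c y \<le> R" "dist c x \<le> R" using c \<open>x \<in> K\<close> R by auto
    then have "norm (y - x) \<le> 2 * R" by (metis dist_norm dist_commute dist_triangle_le add_mono mult_2)
    then show "y \<in> cube x (2 * R)"
      using component_le_norm_cart[of "y - x"] by (auto simp: mem_cube intro: order.trans)
  qed
  moreover have "cube x (\<alpha> / (2 * CARD('n)) * R) \<subseteq> interior K"
  proof -
    have "cube x (\<alpha> / (2 * CARD('n)) * R) \<subseteq> ball x e"
    proof
      fix y assume "y \<in> cube x (\<alpha> / (2 * CARD('n)) * R)"
      then have "norm (y - x) \<le> (\<Sum>i\<in>(UNIV::'n set). \<alpha> / (2 * CARD('n)) * R)"
        by (intro order.trans[OF norm_le_l1_cart] sum_mono) (auto simp: mem_cube)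
      also have "\<dots> = \<alpha> / 2 * R" by simp
      finally show "y \<in> ball x e" using ex(2) by (simp add: dist_norm norm_minus_commute)
    qed
    also have "ball x e \<subseteq> interior K" using ex(1) interior_maximal by blast
    finally show ?thesis .
  qed
  ultimately show ?thesis using that R by blast
qed

text \<open>Absolute integrability survives multiplication by a bounded measurable weight, which is
  all that is known of \<delta> and a on an element.\<close>

lemma absolutely_integrable_on_bounded_open:
  fixes f :: "'a::euclidean_space \<Rightarrow> real"
  assumes "open S" "bounded S" "continuous_on UNIV f"
  shows "f absolutely_integrable_on S"
proof -
  obtain a b where "S \<subseteq> cbox a b" using bounded_subset_cbox_symmetric[OF assms(2)] by metis
  moreover have "f absolutely_integrable_on cbox a b"
    by (intro absolutely_integrable_continuous continuous_on_subset[OF assms(3)]) simp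
  moreover have "S \<in> sets lebesgue" using assms(1) by (simp add: borel_open)
  ultimately show ?thesis using set_integrable_subset by blast
qed

text \<open>A polynomial is defined on the whole space, so its gradient may be integrated over the
  outer cube, which leaves K, and compared with its L2 norm on the inner one. The factor 4 arises
  because \<open>circ_diam\<close> is a diameter and R a radius.\<close>

lemma inverse_inequality_simplex:
  fixes p :: nat
  assumes "\<alpha> > 0"
  obtains C where "C \<ge> 0" "\<And>(K::(real^'n) set) g. (int CARD('n)) simplex K \<Longrightarrow> \<alpha> \<le> insc_diam K / circ_diam K \<Longrightarrow> poly_le p g \<Longrightarrow>
    (circ_diam K)\<^sup>2 * integral (interior K) (\<lambda>x. \<Sum>j\<in>UNIV. (pderiv_at j g x)\<^sup>2) \<le> C * integral (interior K) (\<lambda>x. (g x)\<^sup>2)"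
proof -
  have "\<alpha> / (2 * CARD('n)) > 0" using assms by simp
  then obtain C where C: "C \<ge> 0" "\<And>(g::real^'n \<Rightarrow> real) x R. poly_le p g \<Longrightarrow> R > 0 \<Longrightarrow>
    R\<^sup>2 * integral (cube x (2 * R)) (\<lambda>x. \<Sum>j\<in>UNIV. (pderiv_at j g x)\<^sup>2) \<le>
    C * integral (cube x (\<alpha> / (2 * CARD('n)) * R)) (\<lambda>x. (g x)\<^sup>2)"
    using inverse_inequality_cube[of "\<alpha> / (2 * CARD('n))" p] by metis
  have "(circ_diam K)\<^sup>2 * integral (interior K) (\<lambda>x. \<Sum>j\<in>UNIV. (pderiv_at j g x)\<^sup>2) \<le> (4 * C) * integral (interior K) (\<lambda>x. (g x)\<^sup>2)"
    if K: "(int CARD('n)) simplex K" "\<alpha> \<le> insc_diam K / circ_diam K" and g: "poly_le p g" for K :: "(real^'n) set" and g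
  proof -
    obtain x R where R: "circ_diam K = 2 * R" "R > 0" "K \<subseteq> cube x (2 * R)" "cube x (\<alpha> / (2 * CARD('n)) * R) \<subseteq> interior K"
      using simplex_between_cubes[OF K(1) assms K(2)] by metis
    have bdd: "bounded (interior K)"
      using simplex_compact_convex_interior(1)[OF K(1)] bounded_subset[OF compact_imp_bounded interior_subset] by blast
    have int: "f integrable_on interior K" "f integrable_on cube y r" if "continuous_on UNIV f" for f :: "real^'n \<Rightarrow> real" and y r
    proof -
      show "f integrable_on interior K"
        by (intro set_lebesgue_integral_eq_integral(1) absolutely_integrable_on_bounded_open open_interior bdd that)
      show "f integrable_on cube y r"
        unfolding cube_def by (intro integrable_continuous continuous_on_subset[OF that]) simp
    qed
    have cont: "continuous_on UNIV (\<lambda>x. \<Sum>j\<in>UNIV. (pderiv_at j g x)\<^sup>2)" "continuous_on UNIV (\<lambda>x. (g x)\<^sup>2)"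
      by (intro continuous_intros poly_le_continuous_pderiv[OF g] poly_le_continuous[OF g])+
    have "(circ_diam K)\<^sup>2 * integral (interior K) (\<lambda>x. \<Sum>j\<in>UNIV. (pderiv_at j g x)\<^sup>2)
        \<le> 4 * (R\<^sup>2 * integral (cube x (2 * R)) (\<lambda>x. \<Sum>j\<in>UNIV. (pderiv_at j g x)\<^sup>2))"
      using integral_subset_le[OF subset_trans[OF interior_subset R(3)] int(1)[OF cont(1)] int(2)[OF cont(1)]]
      by (simp add: R(1) power_mult_distrib sum_nonneg mult_left_mono)
    also have "\<dots> \<le> 4 * (C * integral (cube x (\<alpha> / (2 * CARD('n)) * R)) (\<lambda>x. (g x)\<^sup>2))"
      using C(2)[OF g R(2), of x] by simp
    also have "\<dots> \<le> 4 * (C * integral (interior K) (\<lambda>x. (g x)\<^sup>2))"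
      using integral_subset_le[OF R(4) int(2)[OF cont(2)] int(1)[OF cont(2)]] C(1) by (simp add: mult_left_mono)
    finally show ?thesis by simp
  qed
  then show ?thesis using that[of "4 * C"] C(1) by simp
qed

subsection \<open>The finite element space\<close>

lemma FE_space_polynomials:
  assumes "f \<in> FE_space p T" "K \<in> T"
  obtains g where "\<And>i. poly_le p (g i)" "\<And>x i. x \<in> K \<Longrightarrow> f x $ i = g i x"
proof -
  have "\<forall>i. \<exists>g. poly_le p g \<and> (\<forall>x\<in>K. f x $ i = g x)" using assms by (simp add: FE_space_def)
  then show ?thesis using that by metis
qed

text \<open>Near an interior point f coincides with the polynomials of that element. Across a face
  the gradient may jump, which is why the integrals below are taken over element interiors.\<close>

lemma FE_space_has_derivative:
  assumes g: "\<And>i. poly_le p (g i)" "\<And>x i. x \<in> K \<Longrightarrow> f x $ i = g i x" and x: "x \<in> interior K"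
  shows "(f has_derivative (\<lambda>v. \<chi> i. frechet_derivative (g i) (at x) v)) (at x)"
proof -
  have "((\<lambda>y. \<chi> i. g i y) has_derivative (\<lambda>v. \<chi> i. frechet_derivative (g i) (at x) v)) (at x)"
    unfolding has_derivative_componentwise_within[of "\<lambda>y. \<chi> i. g i y"]
    using poly_le_differentiable[OF g(1)] frechet_derivative_works
    by (auto simp: Basis_vec_def inner_axis)
  then show ?thesis
    by (rule has_derivative_transform_within_open[OF _ open_interior x])
       (use interior_subset[of K] g(2) in \<open>simp add: vec_eq_iff subset_iff\<close>)
qed

lemma FE_space_differentiable:
  assumes "f \<in> FE_space p T" "K \<in> T" "x \<in> interior K"
  shows "f differentiable (at x)"
  using FE_space_polynomials[OF assms(1,2)] FE_space_has_derivative[OF _ _ assms(3)] differentiableI by metis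

lemma grad_dot_polynomials:
  assumes g: "\<And>i. poly_le p (g i)" "\<And>x i. x \<in> K \<Longrightarrow> f x $ i = g i x"
    and h: "\<And>i. poly_le p (h i)" "\<And>x i. x \<in> K \<Longrightarrow> k x $ i = h i x" and x: "x \<in> interior K"
  shows "grad_dot f k x = (\<Sum>i\<in>UNIV. \<Sum>j\<in>UNIV. pderiv_at j (g i) x * pderiv_at j (h i) x)"
proof -
  have "frechet_derivative f (at x) = (\<lambda>v. \<chi> i. frechet_derivative (g i) (at x) v)"
    using frechet_derivative_at[OF FE_space_has_derivative[OF g x]] by simp
  moreover have "frechet_derivative k (at x) = (\<lambda>v. \<chi> i. frechet_derivative (h i) (at x) v)"
    using frechet_derivative_at[OF FE_space_has_derivative[OF h x]] by simp
  ultimately show ?thesis by (simp add: grad_dot_def inner_vec_def) (rule sum.swap)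
qed

lemma FE_space_subspace: "subspace (FE_space p T)"
proof (rule subspaceI)
  show "0 \<in> FE_space p T"
    using poly_le_const[of p 0] by (auto simp: FE_space_def zero_fun_def)
next
  fix f g assume fg: "f \<in> FE_space p T" "g \<in> FE_space p T"
  have "\<exists>h. poly_le p h \<and> (\<forall>x\<in>K. (f + g) x $ i = h x)" if K: "K \<in> T" for K i
  proof -
    obtain f' g' where "\<And>i. poly_le p (f' i)" "\<And>x i. x \<in> K \<Longrightarrow> f x $ i = f' i x"
      "\<And>i. poly_le p (g' i)" "\<And>x i. x \<in> K \<Longrightarrow> g x $ i = g' i x"
      using FE_space_polynomials[OF fg(1) K] FE_space_polynomials[OF fg(2) K] by metis
    then show ?thesis using poly_le_axpy[of p "f' i" "g' i" 1] by (intro exI[of _ "\<lambda>x. f' i x + 1 * g' i x"]) auto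
  qed
  then show "f + g \<in> FE_space p T"
    using fg by (auto simp: FE_space_def plus_fun_def intro: continuous_on_add)
next
  fix f c assume f: "f \<in> FE_space p T"
  have "\<exists>h. poly_le p h \<and> (\<forall>x\<in>K. (c *\<^sub>R f) x $ i = h x)" if K: "K \<in> T" for K i
  proof -
    obtain f' where "\<And>i. poly_le p (f' i)" "\<And>x i. x \<in> K \<Longrightarrow> f x $ i = f' i x"
      using FE_space_polynomials[OF f K] by metis
    then show ?thesis using poly_le_cmult[of p "f' i" c] by (intro exI[of _ "\<lambda>x. c * f' i x"]) auto
  qed
  then show "c *\<^sub>R f \<in> FE_space p T"
    using f by (auto simp: FE_space_def scaleR_fun_def intro: continuous_on_scaleR continuous_on_const)
qed

section \<open>Integration over a triangulation\<close>

context
  fixes T :: "(real^'n) set set"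
  assumes T: "triangulation T"
begin

lemma triangulation_simplex: "K \<in> T \<Longrightarrow> (int CARD('n)) simplex K"
  using T by (simp add: triangulation_def)

lemmas triangulation_compact = simplex_compact_convex_interior(1)[OF triangulation_simplex]
lemmas triangulation_convex = simplex_compact_convex_interior(2)[OF triangulation_simplex]
lemmas triangulation_interior_nonempty = simplex_compact_convex_interior(3)[OF triangulation_simplex]

lemma triangulation_finite: "finite T"
  using T by (simp add: triangulation_def)

lemma triangulation_bounded_interior: "K \<in> T \<Longrightarrow> bounded (interior K)"
  using bounded_subset[OF compact_imp_bounded[OF triangulation_compact] interior_subset] by blast

text \<open>A face that meets the relative interior is the whole set. Applied to both simplices, a
  common interior point would give K = L.\<close>

lemma triangulation_disjoint_interiors:
  assumes "K \<in> T" "L \<in> T" "K \<noteq> L"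
  shows "interior K \<inter> interior L = {}"
proof (rule ccontr)
  assume "interior K \<inter> interior L \<noteq> {}"
  then have "(K \<inter> L) \<inter> rel_interior K \<noteq> {}" "(K \<inter> L) \<inter> rel_interior L \<noteq> {}"
    using interior_subset_rel_interior interior_subset by blast+
  moreover have "(K \<inter> L) face_of K" "(K \<inter> L) face_of L"
    using T assms by (auto simp: triangulation_def)
  ultimately have "K \<subseteq> K \<inter> L" "L \<subseteq> K \<inter> L" using subset_of_face_of by blast+
  then show False using assms(3) by blast
qed

text \<open>The two domains differ by part of finitely many frontiers of convex sets, a null set. As
  h is arbitrary, this can rewrite an integral before integrability is known.\<close>

lemma triangulation_integral_interiors:
  fixes h :: "real^'n \<Rightarrow> real"
  shows "integral (interior (\<Union>T)) h = integral (\<Union>K\<in>T. interior K) h"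
proof (rule integral_spike_set)
  have "{x \<in> interior (\<Union>T) - (\<Union>K\<in>T. interior K). h x \<noteq> 0} \<subseteq> (\<Union>K\<in>T. frontier K)"
  proof
    fix x assume "x \<in> {x \<in> interior (\<Union>T) - (\<Union>K\<in>T. interior K). h x \<noteq> 0}"
    then have x: "x \<in> \<Union>T" "\<And>K. K \<in> T \<Longrightarrow> x \<notin> interior K" using interior_subset[of "\<Union>T"] by auto
    then obtain K where "K \<in> T" "x \<in> K" by blast
    then show "x \<in> (\<Union>K\<in>T. frontier K)" using x(2) closure_subset[of K] by (auto simp: frontier_def)
  qed
  moreover have "negligible (\<Union>K\<in>T. frontier K)"
    using triangulation_finite triangulation_convex negligible_convex_frontier by (intro negligible_Union) auto
  ultimately show "negligible {x \<in> interior (\<Union>T) - (\<Union>K\<in>T. interior K). h x \<noteq> 0}"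
    using negligible_subset by blast
  have "(\<Union>K\<in>T. interior K) \<subseteq> interior (\<Union>T)" by (intro UN_least interior_mono) auto
  then have "{x \<in> (\<Union>K\<in>T. interior K) - interior (\<Union>T). h x \<noteq> 0} = {}" by blast
  then show "negligible {x \<in> (\<Union>K\<in>T. interior K) - interior (\<Union>T). h x \<noteq> 0}" by (simp only: negligible_empty)
qed

lemma triangulation_has_integral:
  fixes h :: "real^'n \<Rightarrow> real"
  assumes "\<And>K. K \<in> T \<Longrightarrow> h integrable_on interior K"
  shows "(h has_integral (\<Sum>K\<in>T. integral (interior K) h)) (\<Union>K\<in>T. interior K)"
  using triangulation_finite assms triangulation_disjoint_interiors
  by (intro has_integral_UN) (auto simp: pairwise_def integrable_integral)

text \<open>The functionals evaluate components at determining points. These are chosen inside K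
  because f agrees with its polynomial only there; off the mesh f vanishes by definition of the
  space.\<close>

lemma FE_space_separated: "\<exists>\<Phi>. finite \<Phi> \<and> separates \<Phi> (FE_space p T)"
proof -
  have det: "\<exists>P\<subseteq>K. finite P \<and> (\<forall>g. poly_le p g \<longrightarrow> (\<forall>x\<in>P. g x = 0) \<longrightarrow> (\<forall>x\<in>K. g x = 0))" for K :: "(real^'n) set"
  proof -
    obtain P where P: "P \<subseteq> K" "finite P"
      "\<forall>c. (\<forall>x\<in>P. (\<Sum>\<alpha> | sum \<alpha> UNIV \<le> p. c \<alpha> * multi_monomial \<alpha> x) = 0) \<longrightarrow>
        (\<forall>x\<in>K. (\<Sum>\<alpha> | sum \<alpha> UNIV \<le> p. c \<alpha> * multi_monomial \<alpha> x) = 0)"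
      using finite_determining_set[OF finite_multi_indices[where 'n='n and p=p], where S=K and b=multi_monomial]
      by (elim exE conjE) rule
    have "\<forall>x\<in>K. g x = 0" if "poly_le p g" "\<forall>x\<in>P. g x = 0" for g
    proof -
      obtain c where c: "g = (\<lambda>x. \<Sum>\<alpha> | sum \<alpha> UNIV \<le> p. c \<alpha> * multi_monomial \<alpha> x)"
        using \<open>poly_le p g\<close> by (auto simp: poly_le_def)
      show ?thesis using P(3)[rule_format, of c] that(2) by (auto simp: c)
    qed
    with P(1,2) show ?thesis by blast
  qed
  have "\<exists>P. \<forall>K :: (real^'n) set. P K \<subseteq> K \<and> finite (P K) \<and> (\<forall>g. poly_le p g \<longrightarrow> (\<forall>x\<in>P K. g x = 0) \<longrightarrow> (\<forall>x\<in>K. g x = 0))" 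
    by (intro choice allI) (rule det)
  then obtain P :: "(real^'n) set \<Rightarrow> (real^'n) set" where P': "\<forall>K. P K \<subseteq> K \<and> finite (P K) \<and>
      (\<forall>g. poly_le p g \<longrightarrow> (\<forall>x\<in>P K. g x = 0) \<longrightarrow> (\<forall>x\<in>K. g x = 0))" ..
  then have P: "\<And>K. finite (P K)" "\<And>K. P K \<subseteq> K"
    "\<And>K g x. poly_le p g \<Longrightarrow> \<forall>x\<in>P K. g x = 0 \<Longrightarrow> x \<in> K \<Longrightarrow> g x = 0" by blast+
  define \<Phi> where "\<Phi> = (\<lambda>(x, i) (f :: real^'n \<Rightarrow> real^'n). f x $ i) ` ((\<Union>K\<in>T. P K) \<times> UNIV)"
  have "f = 0" if f: "f \<in> FE_space p T" and 0: "\<forall>\<phi>\<in>\<Phi>. \<phi> f = 0" for f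
  proof
    fix x
    show "f x = 0 x"
    proof (cases "x \<in> \<Union>T")
      case False
      then show ?thesis using f by (simp add: FE_space_def)
    next
      case True
      then obtain K where K: "K \<in> T" "x \<in> K" by blast
      obtain g where g: "\<And>i. poly_le p (g i)" "\<And>x i. x \<in> K \<Longrightarrow> f x $ i = g i x"
        using FE_space_polynomials[OF f K(1)] by metis
      have "f x $ i = 0" for i
      proof -
        have "\<forall>y\<in>P K. g i y = 0"
        proof
          fix y assume y: "y \<in> P K"
          then have "f y $ i = 0" using 0 K by (force simp: \<Phi>_def)
          then show "g i y = 0" using g(2) P(2) y by fastforce
        qed
        then show ?thesis using P(3)[OF g(1)] g(2) K(2) by simp
      qed
      then show ?thesis by (simp add: vec_eq_iff)
    qed
  qed
  moreover have "finite \<Phi>" using P(1) triangulation_finite by (simp add: \<Phi>_def)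
  moreover have "\<forall>\<phi>\<in>\<Phi>. linear_form_on (FE_space p T) \<phi>" by (auto simp: \<Phi>_def linear_form_on_def)
  ultimately show ?thesis unfolding separates_def by blast
qed

lemma FE_space_integrable_inner:
  assumes "f \<in> FE_space p T" "k \<in> FE_space p T" "K \<in> T"
  shows "(\<lambda>x. f x \<bullet> k x) integrable_on interior K"
proof -
  obtain g where g: "\<And>i. poly_le p (g i)" "\<And>x i. x \<in> K \<Longrightarrow> f x $ i = g i x"
    using FE_space_polynomials[OF assms(1,3)] by metis
  obtain h where h: "\<And>i. poly_le p (h i)" "\<And>x i. x \<in> K \<Longrightarrow> k x $ i = h i x"
    using FE_space_polynomials[OF assms(2,3)] by metis
  have "(\<lambda>x. \<Sum>i\<in>UNIV. g i x * h i x) integrable_on interior K"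
    by (intro set_lebesgue_integral_eq_integral(1)[OF absolutely_integrable_on_bounded_open] open_interior
        triangulation_bounded_interior assms(3) continuous_intros poly_le_continuous[OF g(1)] poly_le_continuous[OF h(1)])
  then show ?thesis
    by (rule integrable_eq) (use g(2) h(2) interior_subset[of K] in \<open>simp add: inner_vec_def subset_iff\<close>)
qed

lemma L2ip_psd: "psd_form_on (FE_space p T) (L2ip (interior (\<Union>T)))"
proof -
  have "psd_form_on (FE_space p T) (\<lambda>f g. integral (\<Union>K\<in>T. interior K) (\<lambda>x. f x \<bullet> g x))"
  proof (rule psd_form_on_integral)
    fix f g assume "f \<in> FE_space p T" "g \<in> FE_space p T"
    from triangulation_has_integral[OF FE_space_integrable_inner[OF this]]
    show "(\<lambda>x. f x \<bullet> g x) integrable_on (\<Union>K\<in>T. interior K)" by blast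
  qed (auto simp: inner_commute inner_right_distrib)
  then show ?thesis by (simp add: L2ip_def[abs_def] triangulation_integral_interiors)
qed

lemma L2ip_sum:
  assumes "f \<in> FE_space p T"
  shows "L2ip (interior (\<Union>T)) f f = (\<Sum>K\<in>T. integral (interior K) (\<lambda>x. f x \<bullet> f x))"
  using triangulation_has_integral[OF FE_space_integrable_inner[OF assms assms]]
  by (simp add: L2ip_def triangulation_integral_interiors integral_unique)

text \<open>A zero integral gives f = 0 inside the elements only. Continuity extends this to K, the
  closure of its interior, and the convention that f is 0 off the mesh does the rest. This
  definiteness makes the filter unique.\<close>

lemma L2ip_eq_0:
  assumes f: "f \<in> FE_space p T" and 0: "L2ip (interior (\<Union>T)) f f = 0"
  shows "f = 0"
proof
  fix x
  let ?U = "\<Union>K\<in>T. interior K"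
  have cont: "continuous_on (\<Union>T) f" using f by (simp add: FE_space_def)
  have U: "f y \<bullet> f y = 0" if "y \<in> ?U" for y
  proof (rule integral_eq_0_imp_eq_0_on_open[of ?U "\<lambda>x. f x \<bullet> f x"])
    show "continuous_on ?U (\<lambda>x. f x \<bullet> f x)"
      using continuous_on_subset[OF cont] interior_subset by (intro continuous_intros) blast+
    show "(\<lambda>x. f x \<bullet> f x) integrable_on ?U"
      using triangulation_has_integral[OF FE_space_integrable_inner[OF f f]] by blast
    show "integral ?U (\<lambda>x. f x \<bullet> f x) = 0"
      using 0 by (simp add: L2ip_def triangulation_integral_interiors)
  qed (use that in auto)
  show "f x = 0 x"
  proof (cases "x \<in> \<Union>T")
    case False
    then show ?thesis using f by (simp add: FE_space_def)
  next
    case True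
    then obtain K where K: "K \<in> T" "x \<in> K" by blast
    have cl: "closure (interior K) = K"
      using convex_closure_interior[OF triangulation_convex[OF K(1)] triangulation_interior_nonempty[OF K(1)]]
        triangulation_compact[OF K(1)] by (simp add: compact_imp_closed)
    have "f x = 0"
    proof (rule continuous_constant_on_closure[of "interior K" f 0])
      show "continuous_on (closure (interior K)) f"
        using continuous_on_subset[OF cont] K cl by auto
      show "f y = 0" if "y \<in> interior K" for y
        using U[of y] that K by auto
    qed (use K cl in auto)
    then show ?thesis by simp
  qed
qed

end

subsection \<open>The nonlinear filter\<close>

context
  fixes T :: "(real^'n) set set" and \<delta> a :: "real^'n \<Rightarrow> real" and C\<^sub>\<delta> :: real
  assumes T: "triangulation T"
    and \<delta>: "\<delta> \<in> borel_measurable lebesgue" "\<And>K x. K \<in> T \<Longrightarrow> x \<in> K \<Longrightarrow> \<bar>\<delta> x\<bar> \<le> C\<^sub>\<delta> * circ_diam K"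
    and a: "a \<in> borel_measurable lebesgue" "\<And>x. 0 \<le> a x" "\<And>x. a x \<le> 1"
begin

lemma weight_bounds:
  assumes "K \<in> T" "x \<in> K"
  shows "0 \<le> (\<delta> x)\<^sup>2 * a x" "(\<delta> x)\<^sup>2 * a x \<le> C\<^sub>\<delta>\<^sup>2 * (circ_diam K)\<^sup>2"
proof -
  show "0 \<le> (\<delta> x)\<^sup>2 * a x" using a(2) by simp
  have "(\<delta> x)\<^sup>2 * a x \<le> (\<delta> x)\<^sup>2 * 1" using a(3) by (intro mult_left_mono) auto
  also have "\<dots> \<le> (C\<^sub>\<delta> * circ_diam K)\<^sup>2"
    using power_mono[OF \<delta>(2)[OF assms] abs_ge_zero, of 2] by simp
  finally show "(\<delta> x)\<^sup>2 * a x \<le> C\<^sub>\<delta>\<^sup>2 * (circ_diam K)\<^sup>2" by (simp add: power_mult_distrib)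
qed

lemma FE_space_integrable_weighted_grad:
  assumes f: "f \<in> FE_space p T" and k: "k \<in> FE_space p T" and K: "K \<in> T"
  shows "(\<lambda>x. (\<delta> x)\<^sup>2 * a x * grad_dot f k x) integrable_on interior K"
proof -
  obtain g where g: "\<And>i. poly_le p (g i)" "\<And>x i. x \<in> K \<Longrightarrow> f x $ i = g i x"
    using FE_space_polynomials[OF f K] by metis
  obtain h where h: "\<And>i. poly_le p (h i)" "\<And>x i. x \<in> K \<Longrightarrow> k x $ i = h i x"
    using FE_space_polynomials[OF k K] by metis
  have "(\<lambda>x. \<Sum>i\<in>UNIV. \<Sum>j\<in>UNIV. pderiv_at j (g i) x * pderiv_at j (h i) x) absolutely_integrable_on interior K"
    by (intro absolutely_integrable_on_bounded_open open_interior triangulation_bounded_interior[OF T K] continuous_intros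
        poly_le_continuous_pderiv[OF g(1)] poly_le_continuous_pderiv[OF h(1)])
  moreover have "(\<lambda>x. (\<delta> x)\<^sup>2 * a x) \<in> borel_measurable (lebesgue_on (interior K))"
    using \<delta>(1) a(1) by (intro measurable_restrict_space1) measurable
  moreover have "bounded ((\<lambda>x. (\<delta> x)\<^sup>2 * a x) ` interior K)"
    using weight_bounds[OF K] interior_subset[of K] by (intro boundedI[of _ "C\<^sub>\<delta>\<^sup>2 * (circ_diam K)\<^sup>2"]) (auto simp: subset_iff)
  ultimately have "(\<lambda>x. (\<delta> x)\<^sup>2 * a x * (\<Sum>i\<in>UNIV. \<Sum>j\<in>UNIV. pderiv_at j (g i) x * pderiv_at j (h i) x)) absolutely_integrable_on interior K"
    by (intro absolutely_integrable_bounded_measurable_product[OF bilinear_times]) (auto simp: borel_open)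
  then have "(\<lambda>x. (\<delta> x)\<^sup>2 * a x * (\<Sum>i\<in>UNIV. \<Sum>j\<in>UNIV. pderiv_at j (g i) x * pderiv_at j (h i) x)) integrable_on interior K"
    by (rule set_lebesgue_integral_eq_integral)
  then show ?thesis
    by (rule integrable_eq) (simp add: grad_dot_polynomials[OF g h])
qed

lemma wgrad_ip_psd: "psd_form_on (FE_space p T) (wgrad_ip (interior (\<Union>T)) \<delta> a)"
proof -
  have "psd_form_on (FE_space p T) (\<lambda>f g. integral (\<Union>K\<in>T. interior K) (\<lambda>x. (\<delta> x)\<^sup>2 * a x * grad_dot f g x))"
  proof (rule psd_form_on_integral)
    fix f g assume "f \<in> FE_space p T" "g \<in> FE_space p T"
    from triangulation_has_integral[OF T FE_space_integrable_weighted_grad[OF this]]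
    show "(\<lambda>x. (\<delta> x)\<^sup>2 * a x * grad_dot f g x) integrable_on (\<Union>K\<in>T. interior K)" by blast
  next
    fix f g h c x
    assume V: "f \<in> FE_space p T" "g \<in> FE_space p T" "h \<in> FE_space p T" and "x \<in> (\<Union>K\<in>T. interior K)"
    then obtain K where K: "K \<in> T" "x \<in> interior K" by blast
    have "frechet_derivative (g + c *\<^sub>R h) (at x) v = frechet_derivative g (at x) v + c *\<^sub>R frechet_derivative h (at x) v" for v
      using V K by (intro frechet_derivative_add_scaleR FE_space_differentiable)
    then show "(\<delta> x)\<^sup>2 * a x * grad_dot f (g + c *\<^sub>R h) x = (\<delta> x)\<^sup>2 * a x * grad_dot f g x + c * ((\<delta> x)\<^sup>2 * a x * grad_dot f h x)"
      by (simp add: grad_dot_def inner_right_distrib sum.distrib sum_distrib_left algebra_simps)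
  qed (auto simp: grad_dot_def inner_commute a(2) intro!: mult_nonneg_nonneg sum_nonneg)
  then show ?thesis by (simp add: wgrad_ip_def[abs_def] triangulation_integral_interiors[OF T])
qed

text \<open>On each element the weight is at most
  \<open>C\<^sub>\<delta>\<^sup>2 * (circ_diam K)\<^sup>2\<close>, and the second factor is what the
  scalar inverse inequality absorbs, component by component. As C is common to all elements, the
  estimates add up.\<close>

lemma wgrad_ip_le_L2ip:
  assumes C: "\<And>K g. K \<in> T \<Longrightarrow> poly_le p g \<Longrightarrow>
      (circ_diam K)\<^sup>2 * integral (interior K) (\<lambda>x. \<Sum>j\<in>UNIV. (pderiv_at j g x)\<^sup>2) \<le> C * integral (interior K) (\<lambda>x. (g x)\<^sup>2)"
    and f: "f \<in> FE_space p T"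
  shows "wgrad_ip (interior (\<Union>T)) \<delta> a f f \<le> C\<^sub>\<delta>\<^sup>2 * C * L2ip (interior (\<Union>T)) f f"
proof -
  have "integral (interior K) (\<lambda>x. (\<delta> x)\<^sup>2 * a x * grad_dot f f x) \<le> C\<^sub>\<delta>\<^sup>2 * C * integral (interior K) (\<lambda>x. f x \<bullet> f x)"
    if K: "K \<in> T" for K
  proof -
    obtain g where g: "\<And>i. poly_le p (g i)" "\<And>x i. x \<in> K \<Longrightarrow> f x $ i = g i x"
      using FE_space_polynomials[OF f K] by metis
    have int: "(\<lambda>x. \<Sum>j\<in>UNIV. (pderiv_at j (g i) x)\<^sup>2) integrable_on interior K" "(\<lambda>x. (g i x)\<^sup>2) integrable_on interior K" for i
      by (intro set_lebesgue_integral_eq_integral(1)[OF absolutely_integrable_on_bounded_open] open_interior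
        triangulation_bounded_interior[OF T K] continuous_intros poly_le_continuous[OF g(1)] poly_le_continuous_pderiv[OF g(1)])+
    have "integral (interior K) (\<lambda>x. (\<delta> x)\<^sup>2 * a x * grad_dot f f x) \<le>
      integral (interior K) (\<lambda>x. (C\<^sub>\<delta>\<^sup>2 * (circ_diam K)\<^sup>2) * (\<Sum>i\<in>UNIV. \<Sum>j\<in>UNIV. (pderiv_at j (g i) x)\<^sup>2))"
    proof (rule integral_le)
      show "(\<lambda>x. (C\<^sub>\<delta>\<^sup>2 * (circ_diam K)\<^sup>2) * (\<Sum>i\<in>UNIV. \<Sum>j\<in>UNIV. (pderiv_at j (g i) x)\<^sup>2)) integrable_on interior K"
        by (intro integrable_on_mult_right integrable_sum[where f = "\<lambda>i x. \<Sum>j\<in>UNIV. (pderiv_at j (g i) x)\<^sup>2"] int(1)) simp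
      fix x assume x: "x \<in> interior K"
      then have "x \<in> K" using interior_subset by blast
      have "(\<delta> x)\<^sup>2 * a x * (\<Sum>i\<in>UNIV. \<Sum>j\<in>UNIV. (pderiv_at j (g i) x)\<^sup>2) \<le>
         C\<^sub>\<delta>\<^sup>2 * (circ_diam K)\<^sup>2 * (\<Sum>i\<in>UNIV. \<Sum>j\<in>UNIV. (pderiv_at j (g i) x)\<^sup>2)"
        using weight_bounds[OF K \<open>x \<in> K\<close>] by (intro mult_right_mono sum_nonneg) auto
      then show "(\<delta> x)\<^sup>2 * a x * grad_dot f f x \<le> C\<^sub>\<delta>\<^sup>2 * (circ_diam K)\<^sup>2 * (\<Sum>i\<in>UNIV. \<Sum>j\<in>UNIV. (pderiv_at j (g i) x)\<^sup>2)"
        by (simp add: grad_dot_polynomials[OF g g x] power2_eq_square)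
    qed (rule FE_space_integrable_weighted_grad[OF f f K])
    also have "\<dots> = C\<^sub>\<delta>\<^sup>2 * (\<Sum>i\<in>UNIV. (circ_diam K)\<^sup>2 * integral (interior K) (\<lambda>x. \<Sum>j\<in>UNIV. (pderiv_at j (g i) x)\<^sup>2))"
      by (simp only: integral_mult_right integral_sum[OF finite int(1)] mult.assoc flip: sum_distrib_left)
    also have "\<dots> \<le> C\<^sub>\<delta>\<^sup>2 * (\<Sum>i\<in>UNIV. C * integral (interior K) (\<lambda>x. (g i x)\<^sup>2))"
      using C[OF K g(1)] by (intro mult_left_mono sum_mono) auto
    also have "\<dots> = C\<^sub>\<delta>\<^sup>2 * C * integral (interior K) (\<lambda>x. \<Sum>i\<in>UNIV. (g i x)\<^sup>2)"
      using int(2) by (simp add: integral_sum sum_distrib_left mult.assoc)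
    also have "integral (interior K) (\<lambda>x. \<Sum>i\<in>UNIV. (g i x)\<^sup>2) = integral (interior K) (\<lambda>x. f x \<bullet> f x)"
      using g(2) interior_subset[of K] by (intro integral_cong) (auto simp: inner_vec_def power2_eq_square subset_iff)
    finally show ?thesis .
  qed
  then have "(\<Sum>K\<in>T. integral (interior K) (\<lambda>x. (\<delta> x)\<^sup>2 * a x * grad_dot f f x)) \<le>
     C\<^sub>\<delta>\<^sup>2 * C * (\<Sum>K\<in>T. integral (interior K) (\<lambda>x. f x \<bullet> f x))"
    by (simp add: sum_distrib_left sum_mono)
  moreover have "wgrad_ip (interior (\<Union>T)) \<delta> a f f = (\<Sum>K\<in>T. integral (interior K) (\<lambda>x. (\<delta> x)\<^sup>2 * a x * grad_dot f f x))"
    using triangulation_has_integral[OF T FE_space_integrable_weighted_grad[OF f f]]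
    by (simp add: wgrad_ip_def triangulation_integral_interiors[OF T] integral_unique)
  ultimately show ?thesis by (simp add: L2ip_sum[OF T f])
qed

text \<open>The description operator in \<open>nl_filter\<close> needs existence and uniqueness. The
  sum of both forms inherits definiteness from the L2 part: representation gives existence, and
  testing the difference of two solutions with itself gives uniqueness.\<close>

lemma nl_filter_works:
  fixes w :: "real^'n \<Rightarrow> real^'n"
  assumes w: "w \<in> FE_space p T"
  defines "X \<equiv> FE_space p T" and "\<Omega> \<equiv> interior (\<Union>T)"
  shows "nl_filter X \<Omega> \<delta> a w \<in> X"
    and "v \<in> X \<Longrightarrow> wgrad_ip \<Omega> \<delta> a (nl_filter X \<Omega> \<delta> a w) v + L2ip \<Omega> (nl_filter X \<Omega> \<delta> a w) v = L2ip \<Omega> w v"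
proof -
  let ?B = "\<lambda>f g. wgrad_ip \<Omega> \<delta> a f g + L2ip \<Omega> f g"
  have A: "psd_form_on X (wgrad_ip \<Omega> \<delta> a)" and L: "psd_form_on X (L2ip \<Omega>)"
    using wgrad_ip_psd L2ip_psd[OF T] by (simp_all add: X_def \<Omega>_def)
  have B: "psd_form_on X ?B"
    using A L by (auto simp: psd_form_on_def linear_form_on_def algebra_simps)
  have X: "subspace X" using FE_space_subspace by (simp add: X_def)
  have def: "v = 0" if "v \<in> X" "?B v v = 0" for v
  proof -
    have "L2ip \<Omega> v v = 0"
      using that psd_form_on_nonneg[OF A that(1)] psd_form_on_nonneg[OF L that(1)] by linarith
    then show ?thesis using L2ip_eq_0[OF T] that(1) by (simp add: X_def \<Omega>_def)
  qed
  have wX: "w \<in> X" using w by (simp add: X_def)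
  obtain \<Phi> where \<Phi>: "finite \<Phi>" "separates \<Phi> X" using FE_space_separated[OF T] unfolding X_def by blast
  have "\<exists>z\<in>X. \<forall>v\<in>X. ?B z v = L2ip \<Omega> w v"
  proof (rule riesz_representation_separated[OF \<Phi>(1) X \<Phi>(2) B psd_form_on_linear[OF L wX]])
    show "L2ip \<Omega> w v = 0" if "v \<in> X" "?B v v = 0" for v
      using def[OF that] linear_form_on_0[OF psd_form_on_linear[OF L wX] X] by simp
  qed
  moreover have "z = z'" if z: "z \<in> X" "\<forall>v\<in>X. ?B z v = L2ip \<Omega> w v" and z': "z' \<in> X" "\<forall>v\<in>X. ?B z' v = L2ip \<Omega> w v" for z z'
  proof -
    have d: "z + (-1) *\<^sub>R z' \<in> X" using X z(1) z'(1) by (rule subspace_add_scaleR)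
    have "?B (z + (-1) *\<^sub>R z') (z + (-1) *\<^sub>R z') = ?B (z + (-1) *\<^sub>R z') z + (-1) * ?B (z + (-1) *\<^sub>R z') z'"
      by (rule psd_form_on_add_right[OF B z(1) z'(1) d])
    also have "\<dots> = ?B z (z + (-1) *\<^sub>R z') + (-1) * ?B z' (z + (-1) *\<^sub>R z')"
      using psd_form_on_commute[OF B d z(1)] psd_form_on_commute[OF B d z'(1)] by simp
    also have "\<dots> = 0" using z(2) z'(2) d by simp
    finally have "z + (-1) *\<^sub>R z' = 0" by (rule def[OF d])
    then show ?thesis by simp
  qed
  ultimately have "\<exists>!z. z \<in> X \<and> (\<forall>v\<in>X. ?B z v = L2ip \<Omega> w v)" by blast
  from theI'[OF this] show "nl_filter X \<Omega> \<delta> a w \<in> X"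
    and "v \<in> X \<Longrightarrow> wgrad_ip \<Omega> \<delta> a (nl_filter X \<Omega> \<delta> a w) v + L2ip \<Omega> (nl_filter X \<Omega> \<delta> a w) v = L2ip \<Omega> w v"
    by (simp_all add: nl_filter_def)
qed

lemma G_op_bounds:
  fixes w :: "real^'n \<Rightarrow> real^'n"
  assumes C: "\<And>K g. K \<in> T \<Longrightarrow> poly_le p g \<Longrightarrow>
      (circ_diam K)\<^sup>2 * integral (interior K) (\<lambda>x. \<Sum>j\<in>UNIV. (pderiv_at j g x)\<^sup>2) \<le> C * integral (interior K) (\<lambda>x. (g x)\<^sup>2)"
    and "C \<ge> 0" and w: "w \<in> FE_space p T"
  defines "X \<equiv> FE_space p T" and "\<Omega> \<equiv> interior (\<Union>T)"
  shows "1 / (2 + C\<^sub>\<delta>\<^sup>2 * C) * wgrad_ip \<Omega> \<delta> a w w \<le> L2ip \<Omega> (G_op X \<Omega> \<delta> a w) w"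
    and "L2ip \<Omega> (G_op X \<Omega> \<delta> a w) w \<le> wgrad_ip \<Omega> \<delta> a w w"
proof -
  have G: "G_op X \<Omega> \<delta> a w = w - nl_filter X \<Omega> \<delta> a w" by (simp add: G_op_def fun_diff_def)
  have z: "nl_filter X \<Omega> \<delta> a w \<in> X" using nl_filter_works(1)[OF w] by (simp add: X_def \<Omega>_def)
  have X: "subspace X" using FE_space_subspace by (simp add: X_def)
  have "w - nl_filter X \<Omega> \<delta> a w \<in> X" using X w z by (simp add: X_def subspace_diff)
  then have inv: "wgrad_ip \<Omega> \<delta> a (w - nl_filter X \<Omega> \<delta> a w) (w - nl_filter X \<Omega> \<delta> a w) \<le>
      C\<^sub>\<delta>\<^sup>2 * C * L2ip \<Omega> (w - nl_filter X \<Omega> \<delta> a w) (w - nl_filter X \<Omega> \<delta> a w)"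
    unfolding X_def \<Omega>_def by (intro wgrad_ip_le_L2ip[OF C]) auto
  have eq: "wgrad_ip \<Omega> \<delta> a (nl_filter X \<Omega> \<delta> a w) v + L2ip \<Omega> (nl_filter X \<Omega> \<delta> a w) v = L2ip \<Omega> w v" if "v \<in> X" for v
    using nl_filter_works(2)[OF w] that by (simp add: X_def \<Omega>_def)
  have "C\<^sub>\<delta>\<^sup>2 * C \<ge> 0" using \<open>C \<ge> 0\<close> by simp
  note * = filter_bounds[where A = "wgrad_ip \<Omega> \<delta> a" and B = "L2ip \<Omega>" and C = "C\<^sub>\<delta>\<^sup>2 * C",
      OF X wgrad_ip_psd[of p, folded X_def \<Omega>_def] L2ip_psd[OF T, of p, folded X_def \<Omega>_def] z w[folded X_def] eq inv this]
  show "1 / (2 + C\<^sub>\<delta>\<^sup>2 * C) * wgrad_ip \<Omega> \<delta> a w w \<le> L2ip \<Omega> (G_op X \<Omega> \<delta> a w) w"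
    and "L2ip \<Omega> (G_op X \<Omega> \<delta> a w) w \<le> wgrad_ip \<Omega> \<delta> a w w"
    unfolding G using * by simp_all
qed

end

theorem theorem1:
  fixes p :: nat and C\<^sub>\<delta> \<alpha>\<^sub>0 :: real
  assumes dim: "CARD('n) = 2 \<or> CARD('n) = 3"
    and p: "p \<ge> 1"
    and alpha: "\<alpha>\<^sub>0 > 0"
  shows "\<exists>c>0. \<forall>(T :: (real^'n) set set) (\<Omega> :: (real^'n) set) (\<delta> :: real^'n \<Rightarrow> real)
             (a :: real^'n \<Rightarrow> real) (w :: real^'n \<Rightarrow> real^'n).
      triangulation T \<and> \<Omega> = interior (\<Union>T) \<and> connected \<Omega> \<and>
      (INF K\<in>T. insc_diam K / circ_diam K) = \<alpha>\<^sub>0 \<and>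
      \<delta> \<in> borel_measurable lebesgue \<and> (\<forall>K\<in>T. \<forall>x\<in>K. \<bar>\<delta> x\<bar> \<le> C\<^sub>\<delta> * circ_diam K) \<and>
      a \<in> borel_measurable lebesgue \<and> (\<forall>x. 0 \<le> a x \<and> a x \<le> 1) \<and>
      w \<in> FE_space p T
      \<longrightarrow> c * wgrad_ip \<Omega> \<delta> a w w \<le> L2ip \<Omega> (G_op (FE_space p T) \<Omega> \<delta> a w) w \<and>
          L2ip \<Omega> (G_op (FE_space p T) \<Omega> \<delta> a w) w \<le> wgrad_ip \<Omega> \<delta> a w w"
proof -
  \<comment> \<open>C is fixed before the mesh, \<delta>, a and w are introduced, which is the
    claimed uniformity.\<close>
  obtain C where C: "C \<ge> 0" "\<And>(K::(real^'n) set) g. (int CARD('n)) simplex K \<Longrightarrow> \<alpha>\<^sub>0 \<le> insc_diam K / circ_diam K \<Longrightarrow> poly_le p g \<Longrightarrow>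
    (circ_diam K)\<^sup>2 * integral (interior K) (\<lambda>x. \<Sum>j\<in>UNIV. (pderiv_at j g x)\<^sup>2) \<le> C * integral (interior K) (\<lambda>x. (g x)\<^sup>2)"
    using inverse_inequality_simplex[OF alpha, where 'n='n and p=p] by metis
  show ?thesis
  proof (intro exI[of _ "1 / (2 + C\<^sub>\<delta>\<^sup>2 * C)"] conjI allI impI; (elim conjE)?)
    show "1 / (2 + C\<^sub>\<delta>\<^sup>2 * C) > 0" using C(1) by (simp add: add_pos_nonneg)
    fix T :: "(real^'n) set set" and \<Omega> :: "(real^'n) set" and \<delta> a :: "real^'n \<Rightarrow> real" and w :: "real^'n \<Rightarrow> real^'n"
    assume T: "triangulation T" and \<Omega>: "\<Omega> = interior (\<Union>T)" and \<alpha>: "(INF K\<in>T. insc_diam K / circ_diam K) = \<alpha>\<^sub>0"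
      and \<delta>: "\<delta> \<in> borel_measurable lebesgue" "\<forall>K\<in>T. \<forall>x\<in>K. \<bar>\<delta> x\<bar> \<le> C\<^sub>\<delta> * circ_diam K"
      and a: "a \<in> borel_measurable lebesgue" "\<forall>x. 0 \<le> a x \<and> a x \<le> 1" and w: "w \<in> FE_space p T"
    have "\<alpha>\<^sub>0 \<le> insc_diam K / circ_diam K" if "K \<in> T" for K
      \<comment> \<open>The infimum is a lower bound because finitely many ratios are bounded
        below.\<close>
      unfolding \<alpha>[symmetric] using triangulation_finite[OF T] that by (intro cINF_lower) auto
    then have "(circ_diam K)\<^sup>2 * integral (interior K) (\<lambda>x. \<Sum>j\<in>UNIV. (pderiv_at j g x)\<^sup>2) \<le> C * integral (interior K) (\<lambda>x. (g x)\<^sup>2)"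
      if "K \<in> T" "poly_le p g" for K g
      using C(2) triangulation_simplex[OF T] that by blast
    note bounds = G_op_bounds[OF T \<delta>(1) \<delta>(2)[rule_format] a(1) a(2)[rule_format, THEN conjunct1] a(2)[rule_format, THEN conjunct2]
        this C(1) w]
    show "1 / (2 + C\<^sub>\<delta>\<^sup>2 * C) * wgrad_ip \<Omega> \<delta> a w w \<le> L2ip \<Omega> (G_op (FE_space p T) \<Omega> \<delta> a w) w"
      unfolding \<Omega> by (rule bounds(1))
    show "L2ip \<Omega> (G_op (FE_space p T) \<Omega> \<delta> a w) w \<le> wgrad_ip \<Omega> \<delta> a w w"
      unfolding \<Omega> by (rule bounds(2))
  qed
qed

end
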